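(* Let $D\subset\mathbb{C}^n$ be a domain, let $p\in bD$, and suppose that there exists a local plurisubharmonic peak function $\phi$ at $p$. Then for any neighbourhood $U$ of $p$ there exist a neighbourhood $V\subset U$ of $p$ (with $\phi$ defined on $D\cap V$) and a constant $m>0$ such that, for all $z\in D\cap V$, (i) $k_D(z)\ge e^{m\phi(z)}\,k_{D\cap U}(z)$, and (ii) $q_{D\cap U}(z)\ge e^{m\phi(z)}\,q_D(z)$ (in particular $k_D(z)>0$ and $k_{D\cap U}(z)>0$, so that both quotient invariants are defined).
   Context: $\mathbb{B}^n$ is the open unit ball of $\mathbb{C}^n$; $\mathcal{O}(X,Y)$ is the set of holomorphic maps $X\to Y$; $bD$ is the boundary of $D$; neighbourhoods are open. Volume elements: for a domain (or, by the same formulas, a non-empty open set) $D\subset\mathbb{C}^n$ and $z\in D$, $$c_D(z)=\sup\{|\det\psi'(z)|^2:\psi\in\mathcal{O}(D,\mathbb{B}^n),\ \psi(z)=0\}$$ (Carathéodory--Eisenman volume element), $$k_D(z)=\inf\{|\det\psi'(0)|^{-2}:\psi\in\mathcal{O}(\mathbb{B}^n,D),\ \psi(0)=z\}$$ (Kobayashi--Eisenman volume element; maps with $\det\psi'(0)=0$ contribute $+\infty$). The quotient invariant is $q_D(z)=c_D(z)/k_D(z)$, defined where $k_D(z)>0$. Local plurisubharmonic peak function at $p\in bD$: a function $\phi$ for which there is a neighbourhood $U_0$ of $p$ such that $\phi$ is plurisubharmonic on $D\cap U_0$, $\phi$ extends continuously to $\overline{D}\cap U_0$ with $\phi(p)=0$,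 and $\phi(z)<0$ for $z\in(\overline{D}\cap U_0)\setminus\{p\}$. *)

theory Defs
  imports "HOL-Analysis.Analysis"
begin

(* Complex differentiability: the Frechet derivative is multiplication by a complex matrix.
   Only used for open sets X. *)
definition holomorphic_maps ::
    "(complex ^ 'n) set \<Rightarrow> (complex ^ 'm) set \<Rightarrow> (complex ^ 'n \<Rightarrow> complex ^ 'm) set" where
  "holomorphic_maps X Y =
     {f. (\<forall>z\<in>X. \<exists>A :: complex ^ 'n ^ 'm. (f has_derivative (\<lambda>h. A *v h)) (at z)) \<and> f ` X \<subseteq> Y}"

definition complex_jacobian :: "(complex ^ 'n \<Rightarrow> complex ^ 'm) \<Rightarrow> complex ^ 'n \<Rightarrow> complex ^ 'n ^ 'm" where
  "complex_jacobian f z = matrix (frechet_derivative f (at z))"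

definition caratheodory_volume :: "(complex ^ 'n) set \<Rightarrow> complex ^ 'n \<Rightarrow> ennreal" where
  "caratheodory_volume D z =
     (SUP \<psi> \<in> {\<psi> \<in> holomorphic_maps D (ball (0 :: complex ^ 'n) 1). \<psi> z = 0}.
        ennreal ((cmod (det (complex_jacobian \<psi> z)))\<^sup>2))"

(* In ennreal, inverse 0 is the top element, so degenerate maps contribute infinity. *)
definition kobayashi_volume :: "(complex ^ 'n) set \<Rightarrow> complex ^ 'n \<Rightarrow> ennreal" where
  "kobayashi_volume D z =
     (INF \<psi> \<in> {\<psi> \<in> holomorphic_maps (ball (0 :: complex ^ 'n) 1) D. \<psi> 0 = z}.
        inverse (ennreal ((cmod (det (complex_jacobian \<psi> 0)))\<^sup>2)))"

(* Meaningful only where the denominator is positive. *)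
definition quotient_invariant :: "(complex ^ 'n) set \<Rightarrow> complex ^ 'n \<Rightarrow> ennreal" where
  "quotient_invariant D z = caratheodory_volume D z / kobayashi_volume D z"

(* Lebesgue integral over a real set as positive part minus negative part; it is used only for
   functions that are bounded above on a bounded set, where the first term is finite. *)
definition ereal_integral_on :: "real set \<Rightarrow> (real \<Rightarrow> ereal) \<Rightarrow> ereal" where
  "ereal_integral_on S f =
     enn2ereal (\<integral>\<^sup>+ t\<in>S. e2ennreal (f t) \<partial>lborel) - enn2ereal (\<integral>\<^sup>+ t\<in>S. e2ennreal (- f t) \<partial>lborel)"

(* Values in [-infinity, infinity), upper semicontinuity, and the sub-mean value property on
   every closed complex disc contained in the open set X. The value -infinity is allowed,
   even on a whole component of X. *)
definition plurisubharmonic_on :: "(complex ^ 'n) set \<Rightarrow> (complex ^ 'n \<Rightarrow> ereal) \<Rightarrow> bool" where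
  "plurisubharmonic_on X u \<longleftrightarrow>
     (\<forall>z\<in>X. u z < \<infinity>) \<and>
     (\<forall>c. openin (top_of_set X) {z \<in> X. u z < c}) \<and>
     (\<forall>a b. (\<forall>\<zeta>\<in>cball 0 1. a + \<zeta> *s b \<in> X) \<longrightarrow>
        u a \<le> ereal (1 / (2 * pi)) * ereal_integral_on {0..2 * pi} (\<lambda>\<theta>. u (a + cis \<theta> *s b)))"

(* The peak function is identified with its continuous extension from D \<inter> U0 to closure D \<inter> U0. *)
definition local_psh_peak_function ::
    "(complex ^ 'n) set \<Rightarrow> complex ^ 'n \<Rightarrow> (complex ^ 'n) set \<Rightarrow> (complex ^ 'n \<Rightarrow> ereal) \<Rightarrow> bool" where
  "local_psh_peak_function D p U0 \<phi> \<longleftrightarrow>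
     open U0 \<and> p \<in> U0 \<and>
     plurisubharmonic_on (D \<inter> U0) \<phi> \<and>
     continuous_on (closure D \<inter> U0) \<phi> \<and>
     \<phi> p = 0 \<and> (\<forall>z \<in> closure D \<inter> U0 - {p}. \<phi> z < 0)"

definition exp_ereal :: "ereal \<Rightarrow> ennreal" where
  "exp_ereal x = (case x of ereal r \<Rightarrow> ennreal (exp r) | PInfty \<Rightarrow> \<infinity> | MInfty \<Rightarrow> 0)"

end

theory Submission
  imports Defs "HOL-Complex_Analysis.Complex_Analysis"
begin

text \<open>
Let S = - \<phi>, which is positive, tends to 0 at p and is superharmonic. Everything follows from
one estimate: if f maps the unit ball holomorphically into D with f 0 = z close to p, then f maps
the ball of radius 1 - M S(z) into a fixed small ball around p (ball_escape_estimate). Composing f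
with the dilation of factor 1 - M S(z) gives a competitor for the Kobayashi volume element of the
intersection of D with that small ball, at the cost of the factor (1 - M S(z)) ^ (2 n), and this
factor is at least exp (- m S(z)) when z is close to p (kobayashi_volume_localization). On bounded
sets the Kobayashi volume element is positive by Cauchy's inequality. The two volume elements are
monotone in the domain, so (i) with positivity follows for D and D \<inter> U, and (ii) follows
from (i).

The escape estimate must work for unbounded D, where f itself obeys no bound. First, S is
truncated to a global function on D which equals a constant c off a ball around p
(truncated_barrier). Along a complex line through 0, let the disc f be far from p at a point a.
By the maximum modulus principle f is far from p somewhere on each circle of radius between |a|
and 1. There S \<circ> f = c, and S \<circ> f is superharmonic and nonnegative, so S(f 0) is at
least c times the harmonic measure of this set seen from 0. A set that meets all these circles has
harmonic measure at least a constant times 1 - |a|: this is a weak form of Beurling's projection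
theorem, and it is obtained by comparing S \<circ> f with the logarithm of a Blaschke product
whose zeros are many bad points with evenly spaced moduli (prod_distances_lower_bound,
disc_escape_estimate_closed).

Plurisubharmonicity is given through mean values over linear discs, whereas the comparison
concerns the curved disc f. The two are linked by doubling the variables: in the maximum principle
the point f \<zeta> is replaced by an independent variable w with a penalty k |w - f \<zeta>|^2,
and at a maximum w may be moved along a linear disc (no_interior_maximum,
minimum_principle_on_disc).
\<close>

section \<open>Superharmonicity on linear discs and the doubling of variables\<close>

text \<open>
Superharmonicity is demanded on small linear discs only. This local form makes the gluing of a
superharmonic function with its upper bound immediate: where the bound is attained, the inequality
holds for every radius.
\<close>

definition disc_superharmonic_on :: "(complex ^ 'n) set \<Rightarrow> (complex ^ 'n \<Rightarrow> real) \<Rightarrow> bool" where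
  "disc_superharmonic_on D S \<longleftrightarrow>
     (\<forall>a\<in>D. \<forall>b. \<exists>R>0. \<forall>r. 0 < r \<longrightarrow> r < R \<longrightarrow>
        integral {0..2 * pi} (\<lambda>\<theta>. S (a + (of_real r * cis \<theta>) *s b)) \<le> 2 * pi * S a)"

lemma has_integral_circle_mean:
  assumes g: "g holomorphic_on ball z R" and r: "0 < r" "r < R"
  shows "((\<lambda>\<theta>. g (z + of_real r * cis \<theta>)) has_integral (2 * of_real pi * g z)) {0..2 * pi}"
proof -
  have "((\<lambda>u. g u / (u - z)) has_contour_integral (2 * of_real pi * \<i> * g z)) (circlepath z r)"
  proof (rule Cauchy_integral_circlepath_simple)
    show "g holomorphic_on cball z r"
      using r by (intro holomorphic_on_subset[OF g]) auto
  qed (use r in auto)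
  then have "((\<lambda>t. g (z + r * cis t) / (z + r * cis t - z) * r * \<i> * cis t)
      has_integral (2 * of_real pi * \<i> * g z)) {0..2 * pi}"
    unfolding circlepath_def by (subst (asm) has_contour_integral_part_circlepath_iff) auto
  then have "((\<lambda>t. (g (z + r * cis t) / (z + r * cis t - z) * r * \<i> * cis t) / \<i>)
      has_integral (2 * of_real pi * \<i> * g z) / \<i>) {0..2 * pi}"
    by (rule has_integral_divide)
  moreover have "g (z + r * cis t) / (z + r * cis t - z) * r * \<i> * cis t / \<i> = g (z + r * cis t)" for t
  proof -
    have "x / (a * b) * a * c * b / c = x" if "a \<noteq> 0" "b \<noteq> 0" "c \<noteq> 0" for x a b c :: complex
      using that by simp
    from this[of "of_real r" "cis t" \<i>] show ?thesis
      using r by (simp only: add_diff_cancel_left' complex_i_not_zero cis_neq_zero of_real_eq_0_iff) simp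
  qed
  moreover have "2 * of_real pi * \<i> * g z / \<i> = 2 * of_real pi * g z"
    by (simp only: nonzero_divide_eq_eq complex_i_not_zero not_False_eq_True mult_ac)
  ultimately show ?thesis by (simp only:)
qed

lemma holomorphic_second_order_bound:
  assumes g: "g holomorphic_on ball z R" and R: "0 < R"
  shows "\<exists>C. \<forall>t. cmod t < R / 2 \<longrightarrow> cmod (g (z + t) - g z - t * deriv g z) \<le> C * (cmod t)\<^sup>2"
proof -
  let ?f = "\<lambda>i. (deriv ^^ i) g"
  have hol: "?f i holomorphic_on ball z R" for i
    using g by (intro holomorphic_higher_deriv) auto
  have "compact (?f 2 ` cball z (R / 2))"
    using R by (intro compact_continuous_image holomorphic_on_imp_continuous_on
        holomorphic_on_subset[OF hol]) auto
  then obtain C where C: "\<And>x. x \<in> cball z (R / 2) \<Longrightarrow> cmod (?f 2 x) \<le> C"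
    using compact_imp_bounded bounded_iff by (metis (no_types, lifting) image_eqI)
  have "cmod (g (z + t) - g z - t * deriv g z) \<le> C * (cmod t)\<^sup>2" if t: "cmod t < R / 2" for t
  proof -
    have "cmod (?f 0 (z + t) - (\<Sum>i\<le>1. ?f i z * (z + t - z) ^ i / fact i))
        \<le> C * cmod (z + t - z) ^ Suc 1 / fact 1"
    proof (rule complex_Taylor[where S = "cball z (R / 2)"])
      show "(?f i has_field_derivative ?f (Suc i) x) (at x within cball z (R / 2))"
        if "x \<in> cball z (R / 2)" "i \<le> 1" for i x
      proof -
        have "x \<in> ball z R" using that(1) R by auto
        then have "(?f i has_field_derivative deriv (?f i) x) (at x)"
          using hol holomorphic_derivI open_ball by blast
        then show ?thesis by (simp add: has_field_derivative_at_within)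
      qed
    qed (use C R t in \<open>auto simp: dist_norm numeral_2_eq_2\<close>)
    then show ?thesis by (simp add: numeral_2_eq_2 algebra_simps)
  qed
  then show ?thesis by blast
qed

lemma vector_second_order_bound:
  fixes f :: "complex \<Rightarrow> complex ^ 'n"
  assumes f: "\<And>i. (\<lambda>\<zeta>. f \<zeta> $ i) holomorphic_on ball z R" and R: "0 < R"
  shows "\<exists>C. \<forall>t. cmod t < R / 2 \<longrightarrow>
           norm (f (z + t) - f z - t *s (\<chi> i. deriv (\<lambda>\<zeta>. f \<zeta> $ i) z)) \<le> C * (cmod t)\<^sup>2"
proof -
  obtain C where C: "\<And>i t. cmod t < R / 2 \<Longrightarrow>
      cmod (f (z + t) $ i - f z $ i - t * deriv (\<lambda>\<zeta>. f \<zeta> $ i) z) \<le> C i * (cmod t)\<^sup>2"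
    using holomorphic_second_order_bound[OF f R] by metis
  have "norm (f (z + t) - f z - t *s (\<chi> i. deriv (\<lambda>\<zeta>. f \<zeta> $ i) z)) \<le> sum C UNIV * (cmod t)\<^sup>2"
    if t: "cmod t < R / 2" for t
  proof -
    have "norm (f (z + t) - f z - t *s (\<chi> i. deriv (\<lambda>\<zeta>. f \<zeta> $ i) z))
        \<le> (\<Sum>i\<in>UNIV. cmod ((f (z + t) - f z - t *s (\<chi> i. deriv (\<lambda>\<zeta>. f \<zeta> $ i) z)) $ i))"
      unfolding norm_vec_def by (rule L2_set_le_sum) auto
    also have "\<dots> \<le> (\<Sum>i\<in>UNIV. C i * (cmod t)\<^sup>2)"
      using C[OF t] by (intro sum_mono) simp
    finally show ?thesis by (simp add: sum_distrib_right)
  qed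
  then show ?thesis by blast
qed

lemma inner_eq_Re_sum:
  fixes h v :: "complex ^ 'n"
  shows "inner h v = Re (\<Sum>i\<in>UNIV. cnj (h $ i) * v $ i)"
  by (simp add: inner_vec_def inner_complex_def)

lemma norm_vector_scale:
  fixes v :: "complex ^ 'n"
  shows "norm (t *s v) = cmod t * norm v"
  by (simp add: norm_vec_def norm_mult L2_set_right_distrib)

text \<open>
The reason why superharmonicity on linear discs suffices for holomorphic discs. Composing S with f
directly fails, because f differs from its tangent disc in second order and S is merely
continuous. With an independent second variable w that is only penalised for leaving f \<zeta>, a
maximum at (z, y) can be tested along (z + \<tau>, y + \<tau> b), where b is the derivative of f
at z: now w runs through a linear disc. With h = y - f z and the remainder e of f, the squared
distance changes by |e|^2 = O(r^4) minus twice the inner product of h and e, and the latter is the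
real part of a holomorphic function that vanishes at z, so its mean over circles is zero. The term
\<eta> |\<zeta>|^2 gains \<eta> r^2 in the mean, which wins for small r.
\<close>

lemma no_interior_maximum:
  fixes f :: "complex \<Rightarrow> complex ^ 'n"
  assumes f: "\<And>i. (\<lambda>\<zeta>. f \<zeta> $ i) holomorphic_on ball z R"
    and L: "L holomorphic_on ball z R"
    and S: "disc_superharmonic_on (ball y d) S" "continuous_on (ball y d) S"
    and pos: "0 < R" "0 < d" "0 < \<eta>" "0 \<le> k"
  shows "\<exists>\<zeta> w. \<zeta> \<in> ball z R \<and> w \<in> ball y d \<and>
     Re (L z) + \<eta> * (cmod z)\<^sup>2 - S y - k * (norm (y - f z))\<^sup>2
       < Re (L \<zeta>) + \<eta> * (cmod \<zeta>)\<^sup>2 - S w - k * (norm (w - f \<zeta>))\<^sup>2"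
proof (rule ccontr)
  assume "\<not> ?thesis"
  then have max: "Re (L \<zeta>) + \<eta> * (cmod \<zeta>)\<^sup>2 - S w - k * (norm (w - f \<zeta>))\<^sup>2
      \<le> Re (L z) + \<eta> * (cmod z)\<^sup>2 - S y - k * (norm (y - f z))\<^sup>2"
    if "\<zeta> \<in> ball z R" "w \<in> ball y d" for \<zeta> w
    using that by force
  define b where "b = (\<chi> i. deriv (\<lambda>\<zeta>. f \<zeta> $ i) z)"
  define e where "e \<zeta> = f \<zeta> - f z - (\<zeta> - z) *s b" for \<zeta>
  define h where "h = y - f z"
  obtain C where C: "\<And>t. cmod t < R / 2 \<Longrightarrow> norm (e (z + t)) \<le> C * (cmod t)\<^sup>2"
    using vector_second_order_bound[OF f pos(1)] unfolding e_def b_def by auto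
  obtain R1 where R1: "R1 > 0" and mean: "\<And>r. 0 < r \<Longrightarrow> r < R1 \<Longrightarrow>
      integral {0..2 * pi} (\<lambda>\<theta>. S (y + (of_real r * cis \<theta>) *s b)) \<le> 2 * pi * S y"
    using S(1) pos(2) unfolding disc_superharmonic_on_def by (metis centre_in_ball)
  \<comment> \<open>The part of the expression that is the real part of a holomorphic function.\<close>
  define G where "G \<zeta> = L \<zeta> + 2 * of_real \<eta> * cnj z * (\<zeta> - z)
      + 2 * of_real k * (\<Sum>i\<in>UNIV. cnj (h $ i) * e \<zeta> $ i)" for \<zeta>
  have holG: "G holomorphic_on ball z R"
    unfolding G_def e_def by (auto intro!: holomorphic_intros f L)
  have Gz: "G z = L z" by (simp add: G_def e_def)
  have key: "\<eta> \<le> k * C\<^sup>2 * r\<^sup>2" if r: "0 < r" "r < R1" "r < R / 2" "r * norm b < d" for r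
  proof -
    let ?t = "\<lambda>\<theta>. of_real r * cis \<theta>"
    have nt [simp]: "cmod (?t \<theta>) = r" for \<theta> using r by (simp add: norm_mult)
    have inb: "y + ?t \<theta> *s b \<in> ball y d" for \<theta>
      using r nt[of \<theta>] by (simp add: dist_norm norm_vector_scale)
    have ptw: "Re (G (z + ?t \<theta>)) - Re (L z) + S y + (\<eta> * r\<^sup>2 - k * C\<^sup>2 * r ^ 4)
        \<le> S (y + ?t \<theta> *s b)" for \<theta>
    proof -
      let ?\<tau> = "?t \<theta>"
      have "z + ?\<tau> \<in> ball z R" using r nt[of \<theta>] by (simp add: dist_norm)
      note m = max[OF this inb[of \<theta>]]
      have d: "y + ?\<tau> *s b - f (z + ?\<tau>) = h - e (z + ?\<tau>)"
        by (simp add: h_def e_def)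
      have "(norm (h - e (z + ?\<tau>)))\<^sup>2
          = (norm h)\<^sup>2 - 2 * inner h (e (z + ?\<tau>)) + (norm (e (z + ?\<tau>)))\<^sup>2"
        by (simp add: power2_norm_eq_inner inner_diff_left inner_diff_right inner_commute)
      moreover have "(norm (e (z + ?\<tau>)))\<^sup>2 \<le> C\<^sup>2 * r ^ 4"
      proof -
        have "norm (e (z + ?\<tau>)) \<le> C * r\<^sup>2" using C[of ?\<tau>] r nt[of \<theta>] by simp
        then have "(norm (e (z + ?\<tau>)))\<^sup>2 \<le> (C * r\<^sup>2)\<^sup>2" by (intro power_mono) auto
        then show ?thesis by (simp add: power_mult_distrib flip: power_mult)
      qed
      ultimately have n: "(norm (y + ?\<tau> *s b - f (z + ?\<tau>)))\<^sup>2
          \<le> (norm h)\<^sup>2 - 2 * inner h (e (z + ?\<tau>)) + C\<^sup>2 * r ^ 4"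
        unfolding d by linarith
      have "k * (norm (y + ?\<tau> *s b - f (z + ?\<tau>)))\<^sup>2
          \<le> k * (norm h)\<^sup>2 - 2 * k * inner h (e (z + ?\<tau>)) + k * C\<^sup>2 * r ^ 4"
        using mult_left_mono[OF n pos(4)] by (simp add: algebra_simps)
      moreover have "(cmod (z + ?\<tau>))\<^sup>2 = (cmod z)\<^sup>2 + 2 * Re (cnj z * ?\<tau>) + r\<^sup>2"
      proof -
        have "(cmod (z + ?\<tau>))\<^sup>2 = (cmod z)\<^sup>2 + 2 * Re (cnj z * ?\<tau>) + (cmod ?\<tau>)\<^sup>2"
          unfolding cmod_power2 by (simp add: power2_eq_square algebra_simps)
        then show ?thesis by simp
      qed
      then have "\<eta> * (cmod (z + ?\<tau>))\<^sup>2 = \<eta> * (cmod z)\<^sup>2 + 2 * \<eta> * Re (cnj z * ?\<tau>) + \<eta> * r\<^sup>2"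
        by (simp add: algebra_simps)
      moreover have "Re (G (z + ?\<tau>)) = Re (L (z + ?\<tau>)) + 2 * \<eta> * Re (cnj z * ?\<tau>)
          + 2 * k * inner h (e (z + ?\<tau>))"
      proof -
        have "G (z + ?\<tau>) = L (z + ?\<tau>) + of_real (2 * \<eta>) * (cnj z * ?\<tau>)
            + of_real (2 * k) * (\<Sum>i\<in>UNIV. cnj (h $ i) * e (z + ?\<tau>) $ i)"
          by (simp add: G_def)
        moreover have "Re (of_real x * w) = x * Re w" for x w by simp
        ultimately show ?thesis
          unfolding inner_eq_Re_sum by (simp only: plus_complex.sel)
      qed
      ultimately show ?thesis using m by (simp add: h_def)
    qed
    have iG: "((\<lambda>\<theta>. Re (G (z + ?t \<theta>))) has_integral 2 * pi * Re (L z)) {0..2 * pi}"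
    proof -
      have "((\<lambda>\<theta>. G (z + ?t \<theta>)) has_integral 2 * of_real pi * G z) {0..2 * pi}"
        by (rule has_integral_circle_mean[OF holG]) (use r pos(1) in auto)
      from has_integral_Re[OF this] show ?thesis
        by (simp add: Gz)
    qed
    have cS: "(\<lambda>\<theta>. S (y + ?t \<theta> *s b)) integrable_on {0..2 * pi}"
    proof (rule integrable_continuous_interval)
      show "continuous_on {0..2 * pi} (\<lambda>\<theta>. S (y + ?t \<theta> *s b))"
      proof (rule continuous_on_compose2[OF S(2)])
        show "continuous_on {0..2 * pi} (\<lambda>\<theta>. y + ?t \<theta> *s b)"
          by (simp add: vector_scalar_mult_def) (intro continuous_intros)
      qed (use inb in auto)
    qed
    define c where "c = - Re (L z) + S y + (\<eta> * r\<^sup>2 - k * C\<^sup>2 * r ^ 4)"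
    have "((\<lambda>\<theta>::real. c) has_integral 2 * pi * c) {0..2 * pi}"
      using has_integral_const_real[of c 0 "2 * pi"] by simp
    from has_integral_add[OF iG this]
    have "((\<lambda>\<theta>. Re (G (z + ?t \<theta>)) + c) has_integral 2 * pi * Re (L z) + 2 * pi * c) {0..2 * pi}" .
    from has_integral_le[OF this integrable_integral[OF cS]]
    have "2 * pi * Re (L z) + 2 * pi * c
        \<le> integral {0..2 * pi} (\<lambda>\<theta>. S (y + ?t \<theta> *s b))"
      using ptw by (simp add: c_def algebra_simps)
    also have "\<dots> \<le> 2 * pi * S y" using mean r by blast
    finally have "2 * pi * (\<eta> * r\<^sup>2 - k * C\<^sup>2 * r ^ 4) \<le> 0"
      by (simp add: c_def algebra_simps)
    then have "\<eta> * r\<^sup>2 - k * C\<^sup>2 * r ^ 4 \<le> 0"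
      using pi_gt_zero by (simp only: mult_le_0_iff) linarith
    then have "\<eta> * r\<^sup>2 \<le> (k * C\<^sup>2 * r\<^sup>2) * r\<^sup>2"
      by (simp add: power2_eq_square power4_eq_xxxx mult.assoc)
    then show ?thesis using r by simp
  qed
  have "eventually (\<lambda>r. 0 < r \<and> r < R1 \<and> r < R / 2 \<and> r * norm b < d \<and> k * C\<^sup>2 * r\<^sup>2 < \<eta>) (at_right 0)"
  proof (intro eventually_conj)
    show "eventually (\<lambda>r::real. 0 < r) (at_right 0)" by (rule eventually_at_right_less)
    have small: "eventually (\<lambda>r. r < x) (at_right 0)" if "0 < x" for x :: real
      using that by (auto simp: eventually_at_right_field)
    show "eventually (\<lambda>r. r < R1) (at_right 0)" by (rule small[OF R1])
    show "eventually (\<lambda>r. r < R / 2) (at_right 0)" by (rule small) (use pos(1) in simp)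
    have "((\<lambda>r. r * norm b) \<longlongrightarrow> 0 * norm b) (at_right 0)" by (intro tendsto_intros)
    then show "eventually (\<lambda>r. r * norm b < d) (at_right 0)"
      using pos(2) by (intro order_tendstoD) auto
    have "((\<lambda>r. k * C\<^sup>2 * r\<^sup>2) \<longlongrightarrow> k * C\<^sup>2 * 0\<^sup>2) (at_right 0)" by (intro tendsto_intros)
    then show "eventually (\<lambda>r. k * C\<^sup>2 * r\<^sup>2 < \<eta>) (at_right 0)"
      using pos(3) by (intro order_tendstoD) auto
  qed
  then obtain r where "0 < r" "r < R1" "r < R / 2" "r * norm b < d" "k * C\<^sup>2 * r\<^sup>2 < \<eta>"
    using eventually_happens'[OF trivial_limit_at_right_real] by blast
  with key[of r] show False by linarith
qed

text \<open>
On the part of the disc where |B| exceeds \<beta>, the superharmonic function S \<circ> f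
dominates the harmonic function a ln (1 / |B|), a = c / ln (1 / \<beta>), because it does so on
the boundary of that part: on the unit circle the latter vanishes, and where |B| = \<beta> it
equals c. The difference of the two is maximised with the variable of S doubled. The offset v of
the second variable from f \<zeta> costs k |v|^2; the constant k is so large that the maximal v is
small enough for the boundary values to survive, hence the maximum is interior, in conflict with
the preceding lemma.
\<close>

lemma minimum_principle_on_disc:
  fixes f :: "complex \<Rightarrow> complex ^ 'n"
  assumes D: "open D"
    and S: "disc_superharmonic_on D S" "continuous_on D S" "\<And>w. w \<in> D \<Longrightarrow> 0 \<le> S w"
    and f: "\<And>i. (\<lambda>\<zeta>. f \<zeta> $ i) holomorphic_on ball 0 1" "continuous_on (cball 0 1) f"
      "f ` cball 0 1 \<subseteq> D"
    and B: "B holomorphic_on ball 0 1" "continuous_on (cball 0 1) B"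
      "\<And>\<zeta>. cmod \<zeta> = 1 \<Longrightarrow> cmod (B \<zeta>) = 1"
    and \<beta>: "0 < \<beta>" "\<beta> < 1" and c: "0 \<le> c"
    and small: "\<And>\<zeta>. cmod \<zeta> \<le> 1 \<Longrightarrow> cmod (B \<zeta>) \<le> \<beta> \<Longrightarrow> c \<le> S (f \<zeta>)"
    and B0: "\<beta> \<le> cmod (B 0)"
  shows "c * (- ln (cmod (B 0))) \<le> - ln \<beta> * S (f 0)"
proof (rule ccontr)
  assume contra: "\<not> ?thesis"
  define l where "l = - ln \<beta>"
  have l: "0 < l" using \<beta> by (simp add: l_def)
  define a where "a = c / l"
  have a: "0 \<le> a" "a * l = c" using c l by (auto simp: a_def)
  \<comment> \<open>Half of the assumed violation at the centre; the other half pays for the strictly subharmonic term.\<close>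
  define \<sigma> where "\<sigma> = (- a * ln (cmod (B 0)) - S (f 0)) / 2"
  have \<sigma>: "0 < \<sigma>"
    using contra l unfolding \<sigma>_def a_def l_def[symmetric] by (simp add: field_simps)
  define K where "K = {\<zeta> \<in> cball 0 1. \<beta> \<le> cmod (B \<zeta>)}"
  have contB: "continuous_on (cball 0 1) (\<lambda>\<zeta>. cmod (B \<zeta>))"
    by (intro continuous_intros B)
  have compK: "compact K"
  proof -
    have "closed (cball 0 1 \<inter> (\<lambda>\<zeta>. cmod (B \<zeta>)) -` {\<beta>..})"
      by (rule continuous_closed_preimage[OF contB]) auto
    moreover have "cball 0 1 \<inter> (\<lambda>\<zeta>. cmod (B \<zeta>)) -` {\<beta>..} = K" by (auto simp: K_def)
    ultimately show ?thesis
      by (metis (no_types, lifting) K_def bounded_cball bounded_subset compact_eq_bounded_closed mem_Collect_eq subsetI)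
  qed
  have K0: "0 \<in> K" using B0 by (simp add: K_def)
  have "compact (f ` cball 0 1)" using f(2) by (intro compact_continuous_image) auto
  then obtain d where d: "d > 0" "(\<Union>x\<in>f ` cball 0 1. cball x d) \<subseteq> D"
    using compact_subset_open_imp_cball_epsilon_subset D f(3) by metis
  have inD: "f \<zeta> + v \<in> D" if "cmod \<zeta> \<le> 1" "norm v \<le> d" for \<zeta> v
    using that d(2) by (force simp: dist_norm)
  define Q where "Q = K \<times> cball (0 :: complex ^ 'n) d"
  have compQ: "compact Q" unfolding Q_def by (intro compact_Times compK compact_cball)
  have contf: "continuous_on Q (\<lambda>x. f (fst x))"
    by (rule continuous_on_compose2[OF f(2)]) (auto intro!: continuous_intros simp: Q_def K_def)
  have contS: "continuous_on Q (\<lambda>x. S (f (fst x) + snd x))"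
  proof (rule continuous_on_compose2[OF S(2)])
    show "continuous_on Q (\<lambda>x. f (fst x) + snd x)" by (intro continuous_intros contf)
  qed (auto intro!: inD simp: Q_def K_def)
  have "uniformly_continuous_on Q (\<lambda>x. S (f (fst x) + snd x))"
    using compact_uniformly_continuous contS compQ by blast
  then obtain d' where d': "d' > 0" "\<And>x x'. x \<in> Q \<Longrightarrow> x' \<in> Q \<Longrightarrow> dist x' x < d' \<Longrightarrow>
      dist (S (f (fst x') + snd x')) (S (f (fst x) + snd x)) < \<sigma>"
    using \<sigma> unfolding uniformly_continuous_on_def by metis
  define m where "m = min d d'"
  have m: "0 < m" "m \<le> d" "m \<le> d'" using d d' by (auto simp: m_def)
  \<comment> \<open>Since the maximum of T is positive, this k forces |v| < m.\<close>
  define k where "k = c / m\<^sup>2"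
  have k: "0 \<le> k" "k * m\<^sup>2 = c" using c m by (auto simp: k_def)
  define T where "T x = - a * ln (cmod (B (fst x))) + \<sigma> * (cmod (fst x))\<^sup>2 - \<sigma>
      - S (f (fst x) + snd x) - k * (norm (snd x))\<^sup>2" for x :: "complex \<times> (complex ^ 'n)"
  have "continuous_on Q (\<lambda>x. cmod (B (fst x)))"
    by (rule continuous_on_compose2[OF contB]) (auto intro!: continuous_intros simp: Q_def K_def)
  then have "continuous_on Q (\<lambda>x. ln (cmod (B (fst x))))"
    using \<beta> by (intro continuous_on_ln) (auto simp: Q_def K_def)
  then have "continuous_on Q T"
    unfolding T_def by (intro continuous_on_diff continuous_on_add continuous_on_mult
        continuous_on_const contS continuous_on_power continuous_on_norm continuous_on_fst
        continuous_on_snd continuous_on_id)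
  moreover have "Q \<noteq> {}" using K0 d(1) by (auto simp: Q_def)
  ultimately obtain x0 where x0: "x0 \<in> Q" "\<And>x. x \<in> Q \<Longrightarrow> T x \<le> T x0"
    using continuous_attains_sup[OF compQ] by metis
  obtain z v where zv: "x0 = (z, v)" by force
  have z: "cmod z \<le> 1" "\<beta> \<le> cmod (B z)" and v: "norm v \<le> d"
    using x0(1) by (auto simp: zv Q_def K_def)
  have max: "T (\<zeta>, u) \<le> T (z, v)" if "\<zeta> \<in> K" "norm u \<le> d" for \<zeta> u
    using x0(2)[of "(\<zeta>, u)"] that by (simp add: zv Q_def)
  have "T (0, 0) = \<sigma>" by (simp add: T_def \<sigma>_def field_simps)
  then have Tz: "\<sigma> \<le> T (z, v)" using max[OF K0, of 0] d(1) by simp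
  have lnB: "- a * ln (cmod (B z)) \<le> c"
  proof -
    have "ln \<beta> \<le> ln (cmod (B z))" using z(2) \<beta> by (intro ln_mono) auto
    then have "a * (- ln (cmod (B z))) \<le> a * l" unfolding l_def by (intro mult_left_mono a) auto
    then show ?thesis using a by simp
  qed
  have z1: "\<sigma> * (cmod z)\<^sup>2 \<le> \<sigma>"
    using z(1) \<sigma> by (simp add: power_le_one mult_left_le)
  have Spos: "0 \<le> S (f z + v)" using S(3) inD z(1) v by blast
  have kv: "k * (norm v)\<^sup>2 < k * m\<^sup>2"
    using Tz lnB z1 Spos \<sigma> unfolding k(2) by (simp only: T_def fst_conv snd_conv)
  then have vm: "norm v < m"
    using k(1) m(1) by (metis less_eq_real_def linorder_not_le mult_left_mono norm_ge_zero power_mono)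
  have zlt: "cmod z < 1"
  proof (rule ccontr)
    assume "\<not> ?thesis"
    then have "cmod z = 1" using z(1) by simp
    then have "T (z, v) \<le> 0" using B(3)[of z] Spos mult_nonneg_nonneg[OF k(1), of "(norm v)\<^sup>2"] by (simp add: T_def)
    then show False using Tz \<sigma> by simp
  qed
  have Bgt: "\<beta> < cmod (B z)"
  proof (rule ccontr)
    assume "\<not> ?thesis"
    then have "c \<le> S (f z)" using small z by simp
    moreover have "dist (S (f z + v)) (S (f z)) < \<sigma>"
    proof -
      have "(z, 0) \<in> Q" "(z, v) \<in> Q" using x0(1) d(1) by (auto simp: zv Q_def)
      moreover have "dist (z, v) (z, 0) < d'" using vm m by (simp add: dist_Pair_Pair)
      ultimately show ?thesis using d'(2)[of "(z, 0)" "(z, v)"] by simp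
    qed
    ultimately have "c - \<sigma> < S (f z + v)" by (auto simp: dist_real_def)
    moreover have "0 \<le> k * (norm v)\<^sup>2" using k by simp
    ultimately have "T (z, v) < \<sigma>" using lnB z1 unfolding T_def fst_conv snd_conv by linarith
    then show False using Tz by simp
  qed
  define \<delta> where "\<delta> = (m - norm v) / 2"
  have \<delta>: "0 < \<delta>" "\<delta> + \<delta> + norm v = m" using vm by (auto simp: \<delta>_def)
  have "eventually (\<lambda>\<zeta>. \<zeta> \<in> ball 0 1 \<and> \<beta> < cmod (B \<zeta>) \<and> dist (f \<zeta>) (f z) < \<delta>) (nhds z)"
  proof (intro eventually_conj)
    show "eventually (\<lambda>\<zeta>. \<zeta> \<in> ball 0 1) (nhds z)"
      using zlt by (intro eventually_nhds_in_open) auto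
    have zint: "z \<in> interior (cball 0 1)" using zlt by simp
    have "isCont (\<lambda>\<zeta>. cmod (B \<zeta>)) z" "isCont f z"
      using continuous_on_interior[OF contB zint] continuous_on_interior[OF f(2) zint] by auto
    then have "((\<lambda>\<zeta>. cmod (B \<zeta>)) \<longlongrightarrow> cmod (B z)) (nhds z)" "(f \<longlongrightarrow> f z) (nhds z)"
      using tendsto_at_iff_tendsto_nhds[of "\<lambda>\<zeta>. cmod (B \<zeta>)" z] tendsto_at_iff_tendsto_nhds[of f z]
      by (simp_all only: isCont_def)
    then show "eventually (\<lambda>\<zeta>. \<beta> < cmod (B \<zeta>)) (nhds z)" "eventually (\<lambda>\<zeta>. dist (f \<zeta>) (f z) < \<delta>) (nhds z)"
      using Bgt \<delta>(1) by (auto intro: order_tendstoD tendstoD)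
  qed
  then obtain R where R: "0 < R" "\<And>\<zeta>. \<zeta> \<in> ball z R \<Longrightarrow>
      \<zeta> \<in> ball 0 1 \<and> \<beta> < cmod (B \<zeta>) \<and> dist (f \<zeta>) (f z) < \<delta>"
    unfolding eventually_nhds_metric by (metis dist_commute mem_ball)
  have sub: "ball z R \<subseteq> ball 0 1" using R(2) by blast
  obtain g where g: "g holomorphic_on ball z R" "\<And>x. x \<in> ball z R \<Longrightarrow> exp (g x) = B x"
  proof (rule holomorphic_logarithm_exists[OF convex_ball open_ball, of B z R z])
    show "B holomorphic_on ball z R" by (rule holomorphic_on_subset[OF B(1) sub])
    show "B x \<noteq> 0" if "x \<in> ball z R" for x using R(2)[OF that] \<beta>(1) by auto
    show "z \<in> ball z R" using R(1) by simp
  qed blast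
  have Reg: "Re (g \<zeta>) = ln (cmod (B \<zeta>))" if "\<zeta> \<in> ball z R" for \<zeta>
    using g(2)[OF that] by (metis ln_exp norm_exp_eq_Re)
  have subD: "ball (f z + v) \<delta> \<subseteq> D"
  proof
    fix w assume w: "w \<in> ball (f z + v) \<delta>"
    have "norm (w - f z) \<le> norm (w - (f z + v)) + norm v"
      using norm_triangle_ineq[of "w - (f z + v)" v] by simp
    then have "norm (w - f z) \<le> d" using w \<delta> m by (simp add: dist_norm norm_minus_commute)
    from inD[OF z(1) this] show "w \<in> D" by simp
  qed
  have "\<exists>\<zeta> w. \<zeta> \<in> ball z R \<and> w \<in> ball (f z + v) \<delta> \<and>
     Re (- of_real a * g z) + \<sigma> * (cmod z)\<^sup>2 - S (f z + v) - k * (norm (f z + v - f z))\<^sup>2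
       < Re (- of_real a * g \<zeta>) + \<sigma> * (cmod \<zeta>)\<^sup>2 - S w - k * (norm (w - f \<zeta>))\<^sup>2"
  proof (rule no_interior_maximum)
    show "(\<lambda>\<zeta>. f \<zeta> $ i) holomorphic_on ball z R" for i
      using holomorphic_on_subset[OF f(1) sub] .
    show "(\<lambda>\<zeta>. - of_real a * g \<zeta>) holomorphic_on ball z R"
      by (intro holomorphic_intros g)
    show "disc_superharmonic_on (ball (f z + v) \<delta>) S"
      using S(1) subD unfolding disc_superharmonic_on_def by blast
    show "continuous_on (ball (f z + v) \<delta>) S"
      using S(2) subD continuous_on_subset by blast
  qed (use R \<delta> \<sigma> k in auto)
  then obtain \<zeta> w where \<zeta>: "\<zeta> \<in> ball z R" and w: "w \<in> ball (f z + v) \<delta>" and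
    gt: "Re (- of_real a * g z) + \<sigma> * (cmod z)\<^sup>2 - S (f z + v) - k * (norm (f z + v - f z))\<^sup>2
       < Re (- of_real a * g \<zeta>) + \<sigma> * (cmod \<zeta>)\<^sup>2 - S w - k * (norm (w - f \<zeta>))\<^sup>2"
    by blast
  have "norm (w - f \<zeta>) \<le> norm (w - (f z + v)) + norm (f z - f \<zeta>) + norm v"
    using norm_triangle_ineq[of "w - (f z + v)" "f z - f \<zeta> + v"] norm_triangle_ineq[of "f z - f \<zeta>" v]
    by simp
  also have "\<dots> \<le> d"
    using w R(2)[OF \<zeta>] \<delta> m by (simp add: dist_norm norm_minus_commute)
  finally have "T (\<zeta>, w - f \<zeta>) \<le> T (z, v)"
    using R(2)[OF \<zeta>] by (intro max) (auto simp: K_def)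
  then show False using gt Reg[OF \<zeta>] Reg[of z] R(1) by (simp add: T_def)
qed

section \<open>Blaschke products with zeros of evenly spaced moduli\<close>

text \<open>
This is N! \<ge> (N / e) ^ N together with 12 < e ^ 3.
\<close>

lemma exp_minus_le_prod_fractions:
  assumes N: "0 < N"
  shows "exp (- 4 * real N) \<le> (\<Prod>k=1..N. real k / (12 * real N))"
proof -
  have "(\<Sum>k\<in>{N}. real N ^ k /\<^sub>R fact k) \<le> (\<Sum>k. real N ^ k /\<^sub>R fact k)"
    by (rule sum_le_suminf) (use sums_summable[OF exp_converges[of "real N"]] in auto)
  then have "real N ^ N / fact N \<le> exp (real N)"
    using sums_unique[OF exp_converges[of "real N"]] by (simp add: field_simps)
  then have "exp (- real N) \<le> fact N / real N ^ N"
    using N by (simp add: exp_minus field_simps)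
  moreover have "exp (- 3 * real N) \<le> 1 / 12 ^ N"
  proof -
    have "(5 / 2 :: real) \<le> exp 1" using exp_lower_Taylor_quadratic[of 1] by simp
    then have "(5 / 2 :: real) ^ 3 \<le> exp 1 ^ 3" by (intro power_mono) auto
    moreover have "exp (3 :: real) = exp 1 ^ 3" using exp_of_nat_mult[of 3 "1::real"] by simp
    ultimately have "12 \<le> exp (3 :: real)" by (simp add: power3_eq_cube)
    then have "12 ^ N \<le> exp (3 :: real) ^ N" by (intro power_mono) auto
    then show ?thesis by (simp add: exp_minus field_simps flip: exp_of_nat_mult)
  qed
  ultimately have "exp (- real N) * exp (- 3 * real N) \<le> fact N / real N ^ N * (1 / 12 ^ N)"
    by (intro mult_mono) auto
  also have "fact N / real N ^ N * (1 / 12 ^ N) = (\<Prod>k=1..N. real k / (12 * real N))"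
    by (simp add: fact_prod prod_dividef power_mult_distrib)
  finally show ?thesis by (simp flip: exp_add)
qed

lemma prod_fractions_le_subfamily:
  assumes g: "inj_on g A" "g ` A \<subseteq> {1..N}"
  shows "(\<Prod>k=1..N. real k / (12 * real N)) \<le> (\<Prod>j\<in>A. real (g j) / (12 * real N))"
proof -
  let ?w = "\<lambda>k. real k / (12 * real N)"
  have w: "0 \<le> ?w k" "?w k \<le> 1" if "k \<in> {1..N}" for k
    using that by (auto simp: divide_simps)
  have "(\<Prod>k=1..N. ?w k) = (\<Prod>k\<in>{1..N} - g ` A. ?w k) * (\<Prod>k\<in>g ` A. ?w k)"
    by (rule prod.subset_diff[OF g(2)]) simp
  also have "\<dots> \<le> 1 * (\<Prod>k\<in>g ` A. ?w k)"
    using w g(2) by (intro mult_right_mono prod_le_1 prod_nonneg) auto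
  also have "\<dots> = (\<Prod>j\<in>A. ?w (g j))" using g(1) by (simp add: prod.reindex)
  finally show ?thesis .
qed

text \<open>
The numbers j / (2 N) are spread so evenly that, apart from the point j0 closest to X, the j-th
distance is at least |j - j0| / (4 N); the product over each side of j0 is then at least N! / (12
N) ^ N, so the N-th root of the whole product has a lower bound independent of N. The closest
point contributes at least exp (- N) by assumption. In terms of potential theory: a measure whose
image under \<zeta> \<mapsto> |\<zeta>| is uniform on an interval has a Green potential bounded by
a universal constant.
\<close>

lemma prod_distances_lower_bound:
  fixes b :: "nat \<Rightarrow> real"
  assumes N: "0 < N"
    and q: "\<And>j. j \<in> {1..N} \<Longrightarrow> exp (- real N) \<le> b j"
    and b: "\<And>j. j \<in> {1..N} \<Longrightarrow> min \<bar>X - real j / (2 * real N)\<bar> 1 / 3 \<le> b j"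
  shows "exp (- 9 * real N) \<le> (\<Prod>j=1..N. b j)"
proof -
  define dd where "dd j = \<bar>X - real j / (2 * real N)\<bar>" for j :: nat
  define j0 where "j0 = arg_min_on dd {1..N}"
  have ne: "{1..N} \<noteq> {}" using N by auto
  have j0: "j0 \<in> {1..N}" unfolding j0_def using ne by (intro arg_min_if_finite) auto
  have least: "dd j0 \<le> dd j" if "j \<in> {1..N}" for j
    unfolding j0_def using ne that by (intro arg_min_least) auto
  have far: "\<bar>real j - real j0\<bar> / (12 * real N) \<le> b j" if j: "j \<in> {1..N}" for j
  proof -
    have "\<bar>real j - real j0\<bar> / (2 * real N) = \<bar>real j / (2 * real N) - real j0 / (2 * real N)\<bar>"
      using N by (simp add: abs_divide flip: diff_divide_distrib)
    also have "\<dots> \<le> 2 * dd j"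
    proof -
      have "\<bar>a - c\<bar> \<le> 2 * \<bar>X - a\<bar>" if "\<bar>X - c\<bar> \<le> \<bar>X - a\<bar>" for a c :: real
        using that abs_triangle_ineq4[of "X - c" "X - a"] by simp
      then show ?thesis using least[OF j] unfolding dd_def by blast
    qed
    finally have "\<bar>real j - real j0\<bar> / (4 * real N) \<le> dd j" by (simp add: field_simps)
    moreover have "\<bar>real j - real j0\<bar> / (4 * real N) \<le> 1"
      using j j0 N by (auto simp: divide_simps)
    ultimately show ?thesis using b[OF j] unfolding dd_def by (simp add: field_simps min_def split: if_splits)
  qed
  let ?P = "\<Prod>k=1..N. real k / (12 * real N)"
  have left: "?P \<le> (\<Prod>j\<in>{1..<j0}. b j)"
  proof -
    have "?P \<le> (\<Prod>j\<in>{1..<j0}. real (j0 - j) / (12 * real N))"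
      using j0 by (intro prod_fractions_le_subfamily) (auto simp: inj_on_def)
    also have "\<dots> \<le> (\<Prod>j\<in>{1..<j0}. b j)"
    proof (rule prod_mono)
      fix j assume "j \<in> {1..<j0}"
      then show "0 \<le> real (j0 - j) / (12 * real N) \<and> real (j0 - j) / (12 * real N) \<le> b j"
        using far[of j] j0 by (simp add: of_nat_diff)
    qed
    finally show ?thesis .
  qed
  have right: "?P \<le> (\<Prod>j\<in>{Suc j0..N}. b j)"
  proof -
    have "?P \<le> (\<Prod>j\<in>{Suc j0..N}. real (j - j0) / (12 * real N))"
      by (intro prod_fractions_le_subfamily) (auto simp: inj_on_def)
    also have "\<dots> \<le> (\<Prod>j\<in>{Suc j0..N}. b j)"
    proof (rule prod_mono)
      fix j assume "j \<in> {Suc j0..N}"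
      then show "0 \<le> real (j - j0) / (12 * real N) \<and> real (j - j0) / (12 * real N) \<le> b j"
        using far[of j] j0 by (simp add: of_nat_diff)
    qed
    finally show ?thesis .
  qed
  have P: "exp (- 4 * real N) \<le> ?P" by (rule exp_minus_le_prod_fractions[OF N])
  have "{1..N} = insert j0 ({1..<j0} \<union> {Suc j0..N})" using j0 by auto
  then have "(\<Prod>j=1..N. b j) = b j0 * ((\<Prod>j\<in>{1..<j0}. b j) * (\<Prod>j\<in>{Suc j0..N}. b j))"
    by (simp, subst prod.union_disjoint) auto
  also have "\<dots> \<ge> exp (- real N) * (exp (- 4 * real N) * exp (- 4 * real N))"
  proof (intro mult_mono)
    show "exp (- 4 * real N) \<le> (\<Prod>j\<in>{1..<j0}. b j)" "exp (- 4 * real N) \<le> (\<Prod>j\<in>{Suc j0..N}. b j)"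
      using P left right by linarith+
    then show "0 \<le> (\<Prod>j\<in>{1..<j0}. b j)" using exp_ge_zero order_trans by blast
  qed (use q j0 order_trans[OF exp_ge_zero q[OF j0]] in auto)
  finally show ?thesis by (simp flip: exp_add)
qed

text \<open>
With s = |\<zeta> - \<xi>|, the denominator 1 - cnj \<xi> \<zeta> = (1 - |\<xi>|^2) - cnj \<xi>
(\<zeta> - \<xi>) is at most 2 (1 - r) + s, and s is at least the difference of the moduli. So the
pseudohyperbolic distance is controlled by the moduli alone, measured at the scale 1 - r.
\<close>

lemma Moebius_function_lower_bound:
  assumes r: "r \<le> cmod \<xi>" "cmod \<xi> < 1" and \<zeta>: "cmod \<zeta> \<le> 1"
  shows "min (\<bar>cmod \<zeta> - cmod \<xi>\<bar> / (1 - r)) 1 / 3 \<le> cmod (Moebius_function 0 \<xi> \<zeta>)"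
    and "cmod (\<zeta> - \<xi>) / 2 \<le> cmod (Moebius_function 0 \<xi> \<zeta>)"
proof -
  define s where "s = cmod (\<zeta> - \<xi>)"
  have eq: "cmod (Moebius_function 0 \<xi> \<zeta>) = s / cmod (1 - cnj \<xi> * \<zeta>)"
    by (simp add: Moebius_function_simple norm_divide s_def)
  have prod_lt: "cmod (cnj \<xi> * \<zeta>) < 1"
    using r(2) \<zeta> by (simp add: norm_mult) (smt (verit) mult_left_le norm_ge_zero)
  then have pos: "0 < cmod (1 - cnj \<xi> * \<zeta>)" by auto
  have le2: "cmod (1 - cnj \<xi> * \<zeta>) \<le> 2"
    using norm_triangle_ineq4[of 1 "cnj \<xi> * \<zeta>"] prod_lt by simp
  show "cmod (\<zeta> - \<xi>) / 2 \<le> cmod (Moebius_function 0 \<xi> \<zeta>)"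
    unfolding eq s_def[symmetric] using le2 pos by (intro divide_left_mono) (auto simp: s_def)
  have s0: "0 \<le> s" by (simp add: s_def)
  have "1 - cnj \<xi> * \<zeta> = of_real (1 - (cmod \<xi>)\<^sup>2) - cnj \<xi> * (\<zeta> - \<xi>)"
    by (simp add: algebra_simps flip: complex_norm_square)
  then have "cmod (1 - cnj \<xi> * \<zeta>) \<le> \<bar>1 - (cmod \<xi>)\<^sup>2\<bar> + cmod \<xi> * s"
    using norm_triangle_ineq4[of "of_real (1 - (cmod \<xi>)\<^sup>2)" "cnj \<xi> * (\<zeta> - \<xi>)"]
    by (simp only: norm_of_real norm_mult complex_mod_cnj s_def)
  also have "\<bar>1 - (cmod \<xi>)\<^sup>2\<bar> \<le> 2 * (1 - cmod \<xi>)"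
  proof -
    have "1 - (cmod \<xi>)\<^sup>2 = (1 + cmod \<xi>) * (1 - cmod \<xi>)" by (simp add: power2_eq_square algebra_simps)
    moreover have "0 \<le> (1 + cmod \<xi>) * (1 - cmod \<xi>)" using r by simp
    moreover have "(1 + cmod \<xi>) * (1 - cmod \<xi>) \<le> 2 * (1 - cmod \<xi>)"
      using r by (intro mult_right_mono) auto
    ultimately show ?thesis by simp
  qed
  also have "cmod \<xi> * s \<le> s" using r s0 by (simp add: mult_left_le_one_le)
  finally have den: "cmod (1 - cnj \<xi> * \<zeta>) \<le> 2 * (1 - r) + s" using r by simp
  have r1: "0 < 1 - r" using r by simp
  define t where "t = min (\<bar>cmod \<zeta> - cmod \<xi>\<bar> / (1 - r)) 1"
  have t: "0 \<le> t" "t \<le> 1" "t * (1 - r) \<le> s"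
  proof -
    show "0 \<le> t" "t \<le> 1" using r1 by (auto simp: t_def)
    have "t * (1 - r) \<le> \<bar>cmod \<zeta> - cmod \<xi>\<bar>"
      using r1 by (simp add: t_def min_def field_simps)
    also have "\<dots> \<le> s" unfolding s_def by (rule norm_triangle_ineq3)
    finally show "t * (1 - r) \<le> s" .
  qed
  have "t * cmod (1 - cnj \<xi> * \<zeta>) \<le> t * (2 * (1 - r) + s)" using den t by (intro mult_left_mono)
  also have "\<dots> = 2 * (t * (1 - r)) + t * s" by (simp add: algebra_simps)
  also have "\<dots> \<le> 2 * s + 1 * s" using t s0 by (intro add_mono mult_right_mono) auto
  finally have "t / 3 \<le> s / cmod (1 - cnj \<xi> * \<zeta>)" using pos by (simp add: field_simps)
  then show "min (\<bar>cmod \<zeta> - cmod \<xi>\<bar> / (1 - r)) 1 / 3 \<le> cmod (Moebius_function 0 \<xi> \<zeta>)"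
    unfolding eq t_def .
qed

lemma norm_Moebius_function_unit_circle:
  assumes "cmod \<xi> < 1" "cmod \<zeta> = 1"
  shows "cmod (Moebius_function 0 \<xi> \<zeta>) = 1"
proof -
  have "\<zeta> * cnj \<zeta> = 1" using assms(2) complex_norm_square[of \<zeta>] by simp
  then have "1 - cnj \<xi> * \<zeta> = \<zeta> * cnj (\<zeta> - \<xi>)" by (simp add: algebra_simps)
  then have "cmod (1 - cnj \<xi> * \<zeta>) = cmod (\<zeta> - \<xi>)" using assms(2)
    by (simp only: norm_mult complex_mod_cnj)
  moreover have "\<zeta> \<noteq> \<xi>" using assms by auto
  ultimately show ?thesis by (simp add: Moebius_function_simple norm_divide)
qed

text \<open>
The maximum principle is applied to the real part of the scalar function that pairs f - p with its
value at the given point.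
\<close>

lemma vector_maximum_modulus_circle:
  fixes f :: "complex \<Rightarrow> complex ^ 'n"
  assumes f: "\<And>i. (\<lambda>\<zeta>. f \<zeta> $ i) holomorphic_on ball 0 1" and \<rho>: "0 < \<rho>" "\<rho> < 1"
    and \<zeta>: "cmod \<zeta> \<le> \<rho>"
  shows "\<exists>\<xi>. cmod \<xi> = \<rho> \<and> dist p (f \<zeta>) \<le> dist p (f \<xi>)"
proof -
  have contf: "continuous_on (ball 0 1) f"
    using continuous_on_vec_lambda[of "ball 0 1" "\<lambda>i \<zeta>. f \<zeta> $ i"] f
    by (simp add: holomorphic_on_imp_continuous_on)
  have "continuous_on (sphere 0 \<rho>) (\<lambda>\<xi>. dist p (f \<xi>))"
    using \<rho> by (intro continuous_intros continuous_on_subset[OF contf]) auto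
  moreover have "sphere (0::complex) \<rho> \<noteq> {}" using \<rho> by simp
  ultimately obtain \<xi> where \<xi>: "\<xi> \<in> sphere 0 \<rho>" "\<And>x. x \<in> sphere 0 \<rho> \<Longrightarrow> dist p (f x) \<le> dist p (f \<xi>)"
    using continuous_attains_sup[OF compact_sphere] by metis
  define v where "v = f \<zeta> - p"
  define g where "g x = (\<Sum>i\<in>UNIV. cnj (v $ i) * (f x - p) $ i)" for x
  have g: "Re (g x) = inner v (f x - p)" for x
    by (simp add: g_def inner_eq_Re_sum)
  have holg: "g holomorphic_on ball 0 1"
    unfolding g_def by (auto intro!: holomorphic_intros f)
  have "Re (g \<zeta>) \<le> norm v * dist p (f \<xi>)"
  proof (rule maximum_real_frontier[where f = g and S = "cball 0 \<rho>"])
    show "g holomorphic_on interior (cball 0 \<rho>)" "continuous_on (closure (cball 0 \<rho>)) g"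
      using \<rho> by (auto intro!: holomorphic_on_imp_continuous_on holomorphic_on_subset[OF holg])
    fix x :: complex assume "x \<in> frontier (cball 0 \<rho>)"
    then have "dist p (f x) \<le> dist p (f \<xi>)" using \<xi>(2) \<rho> by (simp add: frontier_cball)
    then have "norm v * norm (f x - p) \<le> norm v * dist p (f \<xi>)"
      by (intro mult_left_mono) (auto simp: dist_norm norm_minus_commute)
    then show "Re (g x) \<le> norm v * dist p (f \<xi>)"
      using norm_cauchy_schwarz[of v "f x - p"] unfolding g by linarith
  qed (use \<zeta> in auto)
  then have "norm v * norm v \<le> norm v * dist p (f \<xi>)"
    unfolding g v_def[symmetric] by (simp add: power2_norm_eq_inner flip: power2_eq_square)
  then have "norm v \<le> dist p (f \<xi>)" by (cases "v = 0") (auto simp: mult_le_cancel_left)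
  then show ?thesis using \<xi>(1) by (auto simp: v_def dist_norm norm_minus_commute)
qed

section \<open>Discs that leave a neighbourhood of the peak point\<close>

text \<open>
If the disc leaves the ball of radius s2 at the point a, then by the maximum principle it does so
somewhere on every circle of radius between r = |a| and 1. The set of bad points therefore meets
all these circles, and such a set must be seen from 0 with harmonic measure at least a constant
times 1 - r. Concretely, N bad points \<xi> j with evenly spaced moduli in the interval from r to
(1 + r) / 2 are the zeros of a Blaschke product B. Near the \<xi> j the function S \<circ> f is at
least c, away from them |B| \<ge> exp (- 9 N), and |B 0| \<le> exp (- N (1 - r) / 2); the minimum
principle turns this into the estimate, in which N cancels.
\<close>

lemma disc_escape_estimate_closed:
  fixes f :: "complex \<Rightarrow> complex ^ 'n"
  assumes D: "open D"
    and S: "disc_superharmonic_on D S" "continuous_on D S" "\<And>w. w \<in> D \<Longrightarrow> 0 \<le> S w"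
    and c: "0 \<le> c" "\<And>w. w \<in> D \<Longrightarrow> s\<^sub>1 \<le> dist p w \<Longrightarrow> c \<le> S w" and s: "s\<^sub>1 < s\<^sub>2"
    and f: "\<And>i. (\<lambda>\<zeta>. f \<zeta> $ i) holomorphic_on ball 0 1" "continuous_on (cball 0 1) f"
      "f ` cball 0 1 \<subseteq> D"
    and a: "cmod a < 1" "s\<^sub>2 \<le> dist p (f a)"
  shows "c * (1 - cmod a) \<le> 20 * S (f 0)"
proof -
  define r where "r = cmod a"
  have r: "0 \<le> r" "r < 1" using a by (auto simp: r_def)
  have "uniformly_continuous_on (cball 0 1) f"
    by (rule compact_uniformly_continuous[OF f(2) compact_cball])
  then obtain d where d: "0 < d" "\<And>x x'. x \<in> cball 0 1 \<Longrightarrow> x' \<in> cball 0 1 \<Longrightarrow> dist x' x < d \<Longrightarrow>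
      dist (f x') (f x) < s\<^sub>2 - s\<^sub>1"
    using uniformly_continuous_onE[of "cball 0 1" f "s\<^sub>2 - s\<^sub>1"] s by auto
  obtain N where N: "0 < N" "exp (- real N) \<le> d / 2"
  proof -
    obtain N :: nat where "- ln (d / 2) < real N" using reals_Archimedean2 by blast
    then have "exp (- real (Suc N)) \<le> exp (ln (d / 2))" by simp
    then show ?thesis using d(1) that[of "Suc N"] by simp
  qed
  \<comment> \<open>The factor 2 keeps all bad points in the closed disc of radius (1 + r) / 2.\<close>
  define \<rho> where "\<rho> j = r + (1 - r) * (real j / (2 * real N))" for j
  have \<rho>: "r < \<rho> j" "\<rho> j \<le> (1 + r) / 2" if "j \<in> {1..N}" for j
  proof -
    have "0 < real j / (2 * real N)" "real j / (2 * real N) \<le> 1 / 2"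
      using that N by (auto simp: divide_simps)
    then have "0 < (1 - r) * (real j / (2 * real N))" "(1 - r) * (real j / (2 * real N)) \<le> (1 - r) * (1 / 2)"
      by (intro mult_pos_pos mult_left_mono; use r in simp)+
    then show "r < \<rho> j" "\<rho> j \<le> (1 + r) / 2" unfolding \<rho>_def by argo+
  qed
  have "\<exists>\<xi>. cmod \<xi> = \<rho> j \<and> s\<^sub>2 \<le> dist p (f \<xi>)" if j: "j \<in> {1..N}" for j
  proof -
    have "0 < \<rho> j" using \<rho>(1)[OF j] r(1) by linarith
    moreover have "\<rho> j < 1" using \<rho>(2)[OF j] r(2) by argo
    moreover have "cmod a \<le> \<rho> j" using \<rho>(1)[OF j] by (simp add: r_def)
    ultimately have "\<exists>\<xi>. cmod \<xi> = \<rho> j \<and> dist p (f a) \<le> dist p (f \<xi>)"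
      by (intro vector_maximum_modulus_circle f)
    then show ?thesis using a(2) by force
  qed
  then obtain \<xi> where \<xi>: "\<And>j. j \<in> {1..N} \<Longrightarrow> cmod (\<xi> j) = \<rho> j" "\<And>j. j \<in> {1..N} \<Longrightarrow> s\<^sub>2 \<le> dist p (f (\<xi> j))"
    by metis
  have \<xi>1: "cmod (\<xi> j) < 1" "r \<le> cmod (\<xi> j)" "0 < cmod (\<xi> j)" if "j \<in> {1..N}" for j
    using \<xi>(1)[OF that] \<rho>[OF that] r by auto
  define B where "B \<zeta> = (\<Prod>j=1..N. Moebius_function 0 (\<xi> j) \<zeta>)" for \<zeta>
  have nearS: "c \<le> S (f \<zeta>)" if \<zeta>: "cmod \<zeta> \<le> 1" and B: "cmod (B \<zeta>) < exp (- 9 * real N)" for \<zeta>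
  proof -
    have "\<exists>j\<in>{1..N}. cmod (\<zeta> - \<xi> j) < d"
    proof (rule ccontr)
      assume "\<not> ?thesis"
      then have far: "d \<le> cmod (\<zeta> - \<xi> j)" if "j \<in> {1..N}" for j using that by force
      have "exp (- 9 * real N) \<le> (\<Prod>j=1..N. cmod (Moebius_function 0 (\<xi> j) \<zeta>))"
      proof (rule prod_distances_lower_bound[OF N(1), where X = "(cmod \<zeta> - r) / (1 - r)"])
        fix j assume j: "j \<in> {1..N}"
        have "d / 2 \<le> cmod (\<zeta> - \<xi> j) / 2" using far[OF j] by simp
        also have "\<dots> \<le> cmod (Moebius_function 0 (\<xi> j) \<zeta>)"
          using Moebius_function_lower_bound(2)[OF \<xi>1(2,1)] j \<zeta> by blast
        finally show "exp (- real N) \<le> cmod (Moebius_function 0 (\<xi> j) \<zeta>)" using N(2) by linarith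
        have "(cmod \<zeta> - r) / (1 - r) - real j / (2 * real N) = (cmod \<zeta> - cmod (\<xi> j)) / (1 - r)"
          using r unfolding \<xi>(1)[OF j] \<rho>_def by (simp add: divide_simps) (simp add: algebra_simps)
        then have "\<bar>(cmod \<zeta> - r) / (1 - r) - real j / (2 * real N)\<bar> = \<bar>cmod \<zeta> - cmod (\<xi> j)\<bar> / (1 - r)"
          using r by (simp add: abs_divide)
        then show "min \<bar>(cmod \<zeta> - r) / (1 - r) - real j / (2 * real N)\<bar> 1 / 3
            \<le> cmod (Moebius_function 0 (\<xi> j) \<zeta>)"
          using Moebius_function_lower_bound(1)[OF \<xi>1(2,1)] j \<zeta> by metis
      qed
      then show False using B by (simp add: B_def prod_norm)
    qed
    then obtain j where j: "j \<in> {1..N}" "cmod (\<zeta> - \<xi> j) < d" by blast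
    then have "dist (f (\<xi> j)) (f \<zeta>) < s\<^sub>2 - s\<^sub>1"
      using \<zeta> \<xi>1[of j] by (intro d(2)) (auto simp: dist_norm norm_minus_commute)
    moreover have "dist p (f (\<xi> j)) \<le> dist p (f \<zeta>) + dist (f (\<xi> j)) (f \<zeta>)"
      by (metis dist_commute dist_triangle)
    ultimately have "s\<^sub>1 \<le> dist p (f \<zeta>)" using \<xi>(2)[OF j(1)] by linarith
    then show ?thesis using c(2) f(3) \<zeta> by (auto simp: image_subset_iff)
  qed
  have S0: "0 \<le> S (f 0)" using S(3) f(3) by (auto simp: image_subset_iff)
  show ?thesis
  proof (cases "cmod (B 0) < exp (- 9 * real N)")
    case True
    then have "c \<le> S (f 0)" using nearS by simp
    moreover have "c * (1 - cmod a) \<le> c * 1" using c(1) by (intro mult_left_mono) auto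
    ultimately show ?thesis using S0 by simp
  next
    case False
    \<comment> \<open>The minimum principle needs the non-strict inequality for |B|, hence 10 in place of 9.\<close>
    have lt: "exp (- 10 * real N) < exp (- 9 * real N)" using N by simp
    have holM: "(\<lambda>\<zeta>. Moebius_function 0 (\<xi> j) \<zeta>) holomorphic_on (ball 0 (1 / \<rho> j))" if j: "j \<in> {1..N}" for j
      unfolding Moebius_function_simple
    proof (intro holomorphic_intros)
      fix \<zeta> :: complex assume "\<zeta> \<in> ball 0 (1 / \<rho> j)"
      then have "cmod (cnj (\<xi> j) * \<zeta>) < 1"
        using \<xi>(1)[OF j] \<xi>1(3)[OF j] by (simp add: norm_mult field_simps)
      then show "1 - cnj (\<xi> j) * \<zeta> \<noteq> 0" by auto
    qed
    have sub: "cball 0 1 \<subseteq> ball 0 (1 / \<rho> j)" if j: "j \<in> {1..N}" for j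
    proof -
      have "1 < 1 / \<rho> j" using \<xi>1[OF j] \<xi>(1)[OF j] by (simp add: field_simps)
      then show ?thesis by auto
    qed
    have holB: "B holomorphic_on cball 0 1"
      unfolding B_def using holomorphic_on_subset[OF holM sub] by (intro holomorphic_on_prod) auto
    have "c * (- ln (cmod (B 0))) \<le> - ln (exp (- 10 * real N)) * S (f 0)"
    proof (rule minimum_principle_on_disc[OF D S f])
      show "B holomorphic_on ball 0 1" using holB by (rule holomorphic_on_subset) auto
      show "continuous_on (cball 0 1) B" using holB by (rule holomorphic_on_imp_continuous_on)
      show "cmod (B \<zeta>) = 1" if "cmod \<zeta> = 1" for \<zeta>
        unfolding B_def prod_norm[symmetric]
        by (rule prod.neutral) (use norm_Moebius_function_unit_circle \<xi>1 that in auto)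
      show "c \<le> S (f \<zeta>)" if "cmod \<zeta> \<le> 1" "cmod (B \<zeta>) \<le> exp (- 10 * real N)" for \<zeta>
        using nearS[OF that(1) le_less_trans[OF that(2) lt]] .
      show "exp (- 10 * real N) \<le> cmod (B 0)" using False lt by linarith
    qed (use N c in auto)
    moreover have "real N * ((1 - r) / 2) \<le> - ln (cmod (B 0))"
    proof -
      have "ln (cmod (B 0)) = (\<Sum>j=1..N. ln (cmod (\<xi> j)))"
        unfolding B_def prod_norm[symmetric] Moebius_function_simple
        using \<xi>1(3) by (subst ln_prod) auto
      also have "\<dots> \<le> (\<Sum>j=1..N. - ((1 - r) / 2))"
      proof (rule sum_mono)
        fix j assume j: "j \<in> {1..N}"
        have "ln (cmod (\<xi> j)) \<le> cmod (\<xi> j) - 1" using \<xi>1(3)[OF j] by (rule ln_le_minus_one)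
        then show "ln (cmod (\<xi> j)) \<le> - ((1 - r) / 2)" using \<xi>(1)[OF j] \<rho>(2)[OF j] by argo
      qed
      finally show ?thesis by simp
    qed
    ultimately have "c * (real N * ((1 - r) / 2)) \<le> 10 * real N * S (f 0)"
      using mult_left_mono[OF _ c(1)] by fastforce
    then have "real N * (c * (1 - r)) \<le> real N * (20 * S (f 0))" by (simp add: field_simps)
    then show ?thesis using N by (simp add: r_def)
  qed
qed

text \<open>
A disc that is holomorphic on the open unit disc only is shrunk to t times its size, and t tends
to 1.
\<close>

lemma disc_escape_estimate:
  fixes f :: "complex \<Rightarrow> complex ^ 'n"
  assumes D: "open D"
    and S: "disc_superharmonic_on D S" "continuous_on D S" "\<And>w. w \<in> D \<Longrightarrow> 0 \<le> S w"
    and c: "0 \<le> c" "\<And>w. w \<in> D \<Longrightarrow> s\<^sub>1 \<le> dist p w \<Longrightarrow> c \<le> S w" and s: "s\<^sub>1 < s\<^sub>2"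
    and f: "\<And>i. (\<lambda>\<zeta>. f \<zeta> $ i) holomorphic_on ball 0 1" "f ` ball 0 1 \<subseteq> D"
    and a: "cmod a < 1" "s\<^sub>2 \<le> dist p (f a)"
  shows "c * (1 - cmod a) \<le> 20 * S (f 0)"
proof -
  have est: "c * (1 - cmod a / t) \<le> 20 * S (f 0)" if t: "cmod a < t" "t < 1" for t
  proof -
    have t0: "0 < t" using t(1) norm_ge_zero le_less_trans by blast
    let ?f = "\<lambda>\<zeta>. f (of_real t * \<zeta>)"
    have maps: "of_real t * \<zeta> \<in> ball 0 1" if "cmod \<zeta> \<le> 1" for \<zeta>
      using that t t0 by (simp add: norm_mult) (smt (verit) mult_left_le)
    have hol: "(\<lambda>\<zeta>. ?f \<zeta> $ i) holomorphic_on cball 0 1" for i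
      using holomorphic_on_compose_gen[of "\<lambda>\<zeta>. of_real t * \<zeta>" "cball 0 1" "\<lambda>\<zeta>. f \<zeta> $ i" "ball 0 1"]
        f(1) maps by (simp add: o_def image_subset_iff holomorphic_intros)
    have "c * (1 - cmod (a / of_real t)) \<le> 20 * S (?f 0)"
    proof (rule disc_escape_estimate_closed[OF D S c s])
      show "(\<lambda>\<zeta>. ?f \<zeta> $ i) holomorphic_on ball 0 1" for i
        using hol by (rule holomorphic_on_subset) auto
      show "continuous_on (cball 0 1) ?f"
        using continuous_on_vec_lambda[of "cball 0 1" "\<lambda>i \<zeta>. ?f \<zeta> $ i"] hol
        by (simp add: holomorphic_on_imp_continuous_on)
      show "?f ` cball 0 1 \<subseteq> D" using f(2) maps by auto
    qed (use a t t0 in \<open>auto simp: norm_divide\<close>)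
    then show ?thesis using t0 by (simp add: norm_divide)
  qed
  have "((\<lambda>t. c * (1 - cmod a / t)) \<longlongrightarrow> c * (1 - cmod a / 1)) (at_left 1)"
    by (intro tendsto_intros) auto
  moreover have "eventually (\<lambda>t. c * (1 - cmod a / t) \<le> 20 * S (f 0)) (at_left 1)"
    using eventually_at_left_real[OF a(1)] est by (auto elim!: eventually_mono)
  ultimately show ?thesis
    using tendsto_upperbound[of _ _ "at_left (1::real)"] by fastforce
qed

section \<open>Truncation of the peak function\<close>

text \<open>
A superharmonic function on all of D made from the negative of the peak function, which lives near
p only: if - \<phi> exceeds c near the sphere of radius s, the truncated function is constant
there and the two branches fit together.
\<close>

definition truncated_barrier ::
    "(complex ^ 'n) set \<Rightarrow> (complex ^ 'n \<Rightarrow> ereal) \<Rightarrow> complex ^ 'n \<Rightarrow> real \<Rightarrow> real \<Rightarrow> complex ^ 'n \<Rightarrow> real" where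
  "truncated_barrier D \<phi> p s c w =
     (if w \<in> D \<inter> ball p s then real_of_ereal (min (- \<phi> w) (ereal c)) else c)"

context
  fixes D U :: "(complex ^ 'n) set" and \<phi> :: "complex ^ 'n \<Rightarrow> ereal" and p :: "complex ^ 'n"
    and s t c :: real
  assumes D: "open D"
    and psh: "plurisubharmonic_on (D \<inter> U) \<phi>" "ball p s \<subseteq> U"
    and cont: "continuous_on (D \<inter> ball p s) \<phi>"
    and neg: "\<And>w. w \<in> D \<inter> ball p s \<Longrightarrow> \<phi> w < 0"
    and outer: "\<And>w. w \<in> D \<inter> ball p s \<Longrightarrow> t \<le> dist p w \<Longrightarrow> \<phi> w \<le> ereal (- c)"
    and ts: "t < s" and c: "0 < c"
begin

private abbreviation "S \<equiv> truncated_barrier D \<phi> p s c"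

lemma ereal_truncated_barrier:
  assumes "w \<in> D \<inter> ball p s"
  shows "ereal (S w) = min (- \<phi> w) (ereal c)"
  using assms neg[OF assms] c unfolding truncated_barrier_def
  by (cases "\<phi> w") (auto simp: min_def)

lemma truncated_barrier_bounds: "0 \<le> S w" "S w \<le> c"
proof -
  have "0 \<le> S w \<and> S w \<le> c"
  proof (cases "w \<in> D \<inter> ball p s")
    case True
    have "0 \<le> min (- \<phi> w) (ereal c)" using neg[OF True] c by (simp add: min_def less_imp_le)
    then show ?thesis unfolding ereal_truncated_barrier[OF True, symmetric]
      using ereal_truncated_barrier[OF True] by (metis ereal_less_eq(3) ereal_less_eq(5) min.cobounded2)
  qed (use c in \<open>auto simp: truncated_barrier_def\<close>)
  then show "0 \<le> S w" "S w \<le> c" by auto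
qed

lemma truncated_barrier_outer:
  assumes "t \<le> dist p w"
  shows "S w = c"
proof (cases "w \<in> D \<inter> ball p s")
  case True
  then have "- ereal (- c) \<le> - \<phi> w" using outer[OF True assms] by (simp only: ereal_minus_le_minus)
  then have "ereal (S w) = ereal c" using ereal_truncated_barrier[OF True] by (simp add: min_def)
  then show ?thesis by simp
qed (auto simp: truncated_barrier_def)

lemma truncated_barrier_eq:
  assumes "w \<in> D \<inter> ball p s" "S w < c"
  shows "\<phi> w = ereal (- S w)"
proof -
  have "min (- \<phi> w) (ereal c) = - \<phi> w"
    using ereal_truncated_barrier[OF assms(1)] assms(2) by (auto simp: min_def split: if_splits)
  then have "ereal (S w) = - \<phi> w" using ereal_truncated_barrier[OF assms(1)] by simp
  then show ?thesis by (metis ereal_uminus_uminus uminus_ereal.simps(1))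
qed

lemma continuous_on_truncated_barrier: "continuous_on D S"
proof -
  have "continuous_on (D \<inter> ball p s) (\<lambda>w. min (- \<phi> w) (ereal c))"
    using cont unfolding continuous_on_def
    by (intro ballI tendsto_min tendsto_uminus_ereal tendsto_const) auto
  then have "continuous_on (D \<inter> ball p s) (\<lambda>w. ereal (S w))"
    by (rule continuous_on_eq) (simp add: ereal_truncated_barrier)
  then have "continuous_on (D \<inter> ball p s) S"
    by (subst (asm) continuous_on_iff_real) (auto simp: o_def)
  moreover have "continuous_on (D - cball p t) S"
    by (rule continuous_on_eq[OF continuous_on_const[of _ c]]) (simp add: truncated_barrier_outer)
  ultimately have "continuous_on (D \<inter> ball p s \<union> (D - cball p t)) S"
    using D by (intro continuous_on_open_Un open_Int open_Diff) auto
  moreover have "D \<inter> ball p s \<union> (D - cball p t) = D" using ts by auto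
  ultimately show ?thesis by simp
qed

text \<open>
Where S attains its global upper bound c, the mean value inequality is trivial. Elsewhere S is -
\<phi> at the centre and at most - \<phi> on the disc, so it inherits the inequality of - \<phi>,
whose extended integral has no negative part.
\<close>

lemma disc_superharmonic_on_truncated_barrier: "disc_superharmonic_on D S"
  unfolding disc_superharmonic_on_def
proof (intro ballI allI)
  fix a b :: "complex ^ 'n" assume a: "a \<in> D"
  show "\<exists>R>0. \<forall>r. 0 < r \<longrightarrow> r < R \<longrightarrow>
      integral {0..2 * pi} (\<lambda>\<theta>. S (a + (of_real r * cis \<theta>) *s b)) \<le> 2 * pi * S a"
  proof (cases "S a < c")
    case False
    then have Sa: "S a = c" using truncated_barrier_bounds[of a] by simp
    have "integral {0..2 * pi} (\<lambda>\<theta>. S (a + (of_real r * cis \<theta>) *s b)) \<le> 2 * pi * c" for r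
    proof (cases "(\<lambda>\<theta>. S (a + (of_real r * cis \<theta>) *s b)) integrable_on {0..2 * pi}")
      case True
      then have "integral {0..2 * pi} (\<lambda>\<theta>. S (a + (of_real r * cis \<theta>) *s b)) \<le> integral {0..2 * pi} (\<lambda>_. c)"
        using truncated_barrier_bounds by (intro integral_le) auto
      then show ?thesis by simp
    qed (use c in \<open>simp add: not_integrable_integral\<close>)
    then show ?thesis unfolding Sa by (intro exI[of _ 1]) auto
  next
    case True
    have ab: "a \<in> D \<inter> ball p s"
      using a True ts truncated_barrier_outer[of a] by force
    then obtain e where e: "0 < e" "ball a e \<subseteq> D \<inter> ball p s"
      using openE[of "D \<inter> ball p s" a] D by auto
    define R where "R = e / (norm b + 1)"
    have R: "0 < R" using e by (simp add: R_def add_nonneg_pos)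
    have "integral {0..2 * pi} (\<lambda>\<theta>. S (a + (of_real r * cis \<theta>) *s b)) \<le> 2 * pi * S a"
      if r: "0 < r" "r < R" for r
    proof -
      define b' where "b' = of_real r *s b"
      have eq: "a + (of_real r * cis \<theta>) *s b = a + cis \<theta> *s b'" for \<theta>
        by (simp add: b'_def mult.commute)
      have "norm b' < e"
      proof -
        have "norm b' = r * norm b" using r by (simp add: b'_def norm_vector_scale)
        also have "\<dots> \<le> r * (norm b + 1)" using r by simp
        also have "\<dots> < e" using r(2) by (simp add: R_def pos_less_divide_eq add_nonneg_pos)
        finally show ?thesis .
      qed
      then have disc: "a + \<zeta> *s b' \<in> D \<inter> ball p s" if "cmod \<zeta> \<le> 1" for \<zeta>
      proof -
        have "norm (\<zeta> *s b') \<le> 1 * norm b'"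
          unfolding norm_vector_scale using that by (intro mult_right_mono) auto
        then have "a + \<zeta> *s b' \<in> ball a e" using \<open>norm b' < e\<close> by (simp add: dist_norm)
        then show ?thesis using e by blast
      qed
      define u where "u \<theta> = \<phi> (a + cis \<theta> *s b')" for \<theta>
      define I where "I = (\<integral>\<^sup>+\<theta>\<in>{0..2 * pi}. e2ennreal (- u \<theta>) \<partial>lborel)"
      have u0: "u \<theta> < 0" for \<theta>
        unfolding u_def by (rule neg[OF disc]) simp
      have "\<phi> a \<le> ereal (1 / (2 * pi)) * ereal_integral_on {0..2 * pi} u"
      proof -
        have "\<forall>\<zeta>\<in>cball 0 1. a + \<zeta> *s b' \<in> D \<inter> U" using disc psh(2) by auto
        then show ?thesis using psh(1) unfolding plurisubharmonic_on_def u_def by blast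
      qed
      moreover have "ereal_integral_on {0..2 * pi} u = - enn2ereal I"
        unfolding ereal_integral_on_def I_def using u0 by (simp add: e2ennreal_neg less_imp_le zero_ennreal.rep_eq)
      ultimately have le: "ereal (- S a) \<le> ereal (1 / (2 * pi)) * (- enn2ereal I)"
        using truncated_barrier_eq[OF ab True] by simp
      obtain i where i: "0 \<le> i" "I = ennreal i"
        using le by (cases I rule: ennreal_cases) auto
      have iS: "i \<le> 2 * pi * S a" using le i by (simp add: field_simps)
      have "continuous_on {0..2 * pi} (\<lambda>\<theta>. S (a + cis \<theta> *s b'))"
      proof (rule continuous_on_compose2[OF continuous_on_truncated_barrier])
        show "continuous_on {0..2 * pi} (\<lambda>\<theta>. a + cis \<theta> *s b')"
          by (simp add: vector_scalar_mult_def) (intro continuous_intros)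
        show "(\<lambda>\<theta>. a + cis \<theta> *s b') ` {0..2 * pi} \<subseteq> D" using disc by auto
      qed
      then have int: "((\<lambda>\<theta>. S (a + cis \<theta> *s b')) has_integral
          integral {0..2 * pi} (\<lambda>\<theta>. S (a + cis \<theta> *s b'))) {0..2 * pi}"
        using integrable_continuous_interval integrable_integral by blast
      have "ennreal (integral {0..2 * pi} (\<lambda>\<theta>. S (a + cis \<theta> *s b')))
          = (\<integral>\<^sup>+\<theta>\<in>{0..2 * pi}. ennreal (S (a + cis \<theta> *s b')) \<partial>lborel)"
        using nn_integral_has_integral_lebesgue'[OF _ int] truncated_barrier_bounds(1) by simp
      also have "\<dots> \<le> I" unfolding I_def
      proof (intro nn_integral_mono mult_right_mono)
        fix \<theta> :: real
        have "ereal (S (a + cis \<theta> *s b')) \<le> - u \<theta>"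
          unfolding u_def using ereal_truncated_barrier[OF disc[of "cis \<theta>"]] by simp
        from e2ennreal_mono[OF this]
        show "ennreal (S (a + cis \<theta> *s b')) \<le> e2ennreal (- u \<theta>)" by simp
      qed auto
      finally have "integral {0..2 * pi} (\<lambda>\<theta>. S (a + cis \<theta> *s b')) \<le> i" using i by simp
      then show ?thesis unfolding eq using iS by linarith
    qed
    then show ?thesis using R by blast
  qed
qed

end

section \<open>Comparison of the volume elements\<close>

lemma complex_jacobian_eq:
  assumes "(f has_derivative (\<lambda>h. A *v h)) (at z)"
  shows "complex_jacobian f z = A"
  unfolding complex_jacobian_def frechet_derivative_at[OF assms, symmetric] by simp

lemma holomorphic_maps_jacobian:
  assumes "f \<in> holomorphic_maps X Y" "z \<in> X"
  shows "(f has_derivative (\<lambda>h. complex_jacobian f z *v h)) (at z)"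
proof -
  obtain A where "(f has_derivative (\<lambda>h. A *v h)) (at z)"
    using assms unfolding holomorphic_maps_def by blast
  then show ?thesis using complex_jacobian_eq by metis
qed

lemma bounded_linear_vector_scale: "bounded_linear (\<lambda>\<zeta>. \<zeta> *s (v :: complex ^ 'n))"
  unfolding linear_conv_bounded_linear[symmetric]
  by (rule linearI) (simp_all add: vec_eq_iff algebra_simps)

lemma slice_has_field_derivative:
  fixes f :: "complex ^ 'n \<Rightarrow> complex ^ 'm"
  assumes f: "f \<in> holomorphic_maps X Y" and \<zeta>: "\<zeta> *s v \<in> X"
  shows "((\<lambda>\<zeta>. f (\<zeta> *s v) $ i) has_field_derivative (complex_jacobian f (\<zeta> *s v) *v v) $ i) (at \<zeta>)"
proof -
  have "((\<lambda>\<zeta>. \<zeta> *s v) has_derivative (\<lambda>\<zeta>. \<zeta> *s v)) (at \<zeta>)"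
    by (rule bounded_linear_imp_has_derivative[OF bounded_linear_vector_scale])
  from has_derivative_compose[OF this holomorphic_maps_jacobian[OF f \<zeta>]]
  have "((\<lambda>\<zeta>. f (\<zeta> *s v)) has_derivative (\<lambda>h. complex_jacobian f (\<zeta> *s v) *v (h *s v))) (at \<zeta>)" .
  then have "((\<lambda>\<zeta>. f (\<zeta> *s v) $ i) has_derivative
      (\<lambda>h. (complex_jacobian f (\<zeta> *s v) *v (h *s v)) $ i)) (at \<zeta>)"
    by (rule bounded_linear.has_derivative[OF bounded_linear_vec_nth])
  moreover have "(\<lambda>h. (complex_jacobian f (\<zeta> *s v) *v (h *s v)) $ i)
      = (*) ((complex_jacobian f (\<zeta> *s v) *v v) $ i)"
    by (simp add: fun_eq_iff matrix_vector_mult_def sum_distrib_left mult_ac)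
  ultimately show ?thesis unfolding has_field_derivative_def by simp
qed

lemma det_scaleR_complex:
  fixes A :: "complex ^ 'n ^ 'n"
  shows "det (r *\<^sub>R A) = of_real r ^ CARD('n) * det A"
  unfolding det_def
  by (simp add: sum_distrib_left prod.distrib scaleR_conv_of_real[of _ "_ :: complex"] mult_ac)

lemma holomorphic_maps_dilation:
  fixes f :: "complex ^ 'n \<Rightarrow> complex ^ 'n"
  assumes f: "f \<in> holomorphic_maps (ball 0 1) D" and r: "0 < r" "r \<le> 1"
    and im: "\<And>w. norm w < r \<Longrightarrow> f w \<in> W"
  shows "(\<lambda>w. f (r *\<^sub>R w)) \<in> holomorphic_maps (ball 0 1) W"
    and "det (complex_jacobian (\<lambda>w. f (r *\<^sub>R w)) 0) = of_real r ^ CARD('n) * det (complex_jacobian f 0)"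
proof -
  have der: "((\<lambda>w. f (r *\<^sub>R w)) has_derivative (\<lambda>h. (r *\<^sub>R complex_jacobian f (r *\<^sub>R w)) *v h)) (at w)"
    if "norm w < 1" for w
  proof -
    have "norm (r *\<^sub>R w) < r" using that r by simp
    then have "norm (r *\<^sub>R w) < 1" using r(2) by linarith
    then have rw: "r *\<^sub>R w \<in> ball 0 1" by (simp only: mem_ball_0)
    have "((\<lambda>w. r *\<^sub>R w) has_derivative (\<lambda>h. r *\<^sub>R h)) (at w)"
      by (intro derivative_intros)
    from has_derivative_compose[OF this holomorphic_maps_jacobian[OF f rw]]
    have "((\<lambda>w. f (r *\<^sub>R w)) has_derivative (\<lambda>h. complex_jacobian f (r *\<^sub>R w) *v (r *\<^sub>R h))) (at w)" .
    moreover have "complex_jacobian f (r *\<^sub>R w) *v (r *\<^sub>R h) = (r *\<^sub>R complex_jacobian f (r *\<^sub>R w)) *v h" for h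
      by (simp add: vec_eq_iff matrix_vector_mult_def)
    ultimately show ?thesis by simp
  qed
  show "(\<lambda>w. f (r *\<^sub>R w)) \<in> holomorphic_maps (ball 0 1) W"
    unfolding holomorphic_maps_def
  proof (intro CollectI conjI ballI)
    show "\<exists>A. ((\<lambda>w. f (r *\<^sub>R w)) has_derivative (\<lambda>h. A *v h)) (at w)" if "w \<in> ball 0 1" for w
      using der[of w] that by auto
    have "f (r *\<^sub>R w) \<in> W" if "w \<in> ball 0 1" for w
      using that r by (intro im) simp
    then show "(\<lambda>w. f (r *\<^sub>R w)) ` ball 0 1 \<subseteq> W" by blast
  qed
  show "det (complex_jacobian (\<lambda>w. f (r *\<^sub>R w)) 0) = of_real r ^ CARD('n) * det (complex_jacobian f 0)"
    using complex_jacobian_eq[OF der[of 0]] by (simp add: det_scaleR_complex)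
qed

lemma inverse_ennreal_antimono:
  fixes x y :: ennreal
  assumes "x \<le> y"
  shows "inverse y \<le> inverse x"
proof (cases x rule: ennreal_cases; cases y rule: ennreal_cases)
  fix a b assume "x = ennreal a" "0 \<le> a" "y = ennreal b" "0 \<le> b"
  then show ?thesis using assms by (cases "a = 0") (auto simp: inverse_ennreal)
qed (use assms in \<open>auto simp: top_unique\<close>)

text \<open>
If the ball of radius r is always mapped into W, the dilated map w \<mapsto> f (r w) competes in
the definition of the volume element of W, and its Jacobian determinant at 0 is r ^ n times the
old one.
\<close>

lemma kobayashi_volume_localization:
  fixes D W :: "(complex ^ 'n) set"
  assumes r: "0 < r" "r \<le> 1"
    and im: "\<And>(f :: complex ^ 'n \<Rightarrow> complex ^ 'n) w. f \<in> holomorphic_maps (ball 0 1) D \<Longrightarrow> f 0 = z \<Longrightarrow> norm w < r \<Longrightarrow> f w \<in> W"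
  shows "ennreal (r ^ (2 * CARD('n))) * kobayashi_volume W z \<le> kobayashi_volume D z"
  unfolding kobayashi_volume_def[of D]
proof (rule INF_greatest)
  fix f :: "complex ^ 'n \<Rightarrow> complex ^ 'n"
  assume "f \<in> {\<psi> \<in> holomorphic_maps (ball 0 1) D. \<psi> 0 = z}"
  then have f: "f \<in> holomorphic_maps (ball 0 1) D" "f 0 = z" by auto
  let ?g = "\<lambda>w. f (r *\<^sub>R w)"
  let ?d = "(cmod (det (complex_jacobian f 0)))\<^sup>2"
  have g: "?g \<in> holomorphic_maps (ball 0 1) W" "?g 0 = z"
    using holomorphic_maps_dilation(1)[OF f(1) r im[OF f]] f(2) by auto
  have "(cmod (det (complex_jacobian ?g 0)))\<^sup>2 = r ^ (2 * CARD('n)) * ?d"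
    using holomorphic_maps_dilation(2)[OF f(1) r im[OF f]] r
    by (simp add: norm_mult norm_power power_mult_distrib mult.commute flip: power_mult)
  then have "kobayashi_volume W z \<le> inverse (ennreal (r ^ (2 * CARD('n)) * ?d))"
    using g unfolding kobayashi_volume_def by (intro INF_lower2[of ?g]) auto
  then have "ennreal (r ^ (2 * CARD('n))) * kobayashi_volume W z
      \<le> ennreal (r ^ (2 * CARD('n))) * inverse (ennreal (r ^ (2 * CARD('n)) * ?d))"
    by (intro mult_left_mono) auto
  also have "\<dots> \<le> inverse (ennreal ?d)"
  proof (cases "?d = 0")
    case False
    then have "0 < ?d" by simp
    then show ?thesis using r by (simp add: inverse_ennreal flip: ennreal_mult)
  qed simp
  finally show "ennreal (r ^ (2 * CARD('n))) * kobayashi_volume W z \<le> inverse (ennreal ?d)" .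
qed

lemma cmod_det_le:
  fixes A :: "complex ^ 'n ^ 'n" and C :: real
  assumes "\<And>i j. cmod (A $ i $ j) \<le> C"
  shows "cmod (det A) \<le> card {q. q permutes (UNIV :: 'n set)} * C ^ CARD('n)"
proof -
  have "cmod (det A) \<le> (\<Sum>q\<in>{q. q permutes (UNIV :: 'n set)}. cmod (of_int (sign q) * (\<Prod>i\<in>UNIV. A $ i $ q i)))"
    unfolding det_def by (rule norm_sum)
  also have "\<dots> \<le> (\<Sum>q\<in>{q. q permutes (UNIV :: 'n set)}. C ^ CARD('n))"
  proof (rule sum_mono)
    fix q
    have "(\<Prod>i\<in>UNIV. cmod (A $ i $ q i)) \<le> (\<Prod>i\<in>(UNIV :: 'n set). C)"
      by (intro prod_mono) (use assms in auto)
    moreover have "cmod (of_int (sign q)) = 1" by (simp add: sign_def)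
    ultimately show "cmod (of_int (sign q) * (\<Prod>i\<in>UNIV. A $ i $ q i)) \<le> C ^ CARD('n)"
      by (simp add: norm_mult prod_norm)
  qed
  finally show ?thesis by simp
qed

lemma cmod_jacobian_entry_le:
  fixes f :: "complex ^ 'n \<Rightarrow> complex ^ 'n"
  assumes f: "f \<in> holomorphic_maps (ball 0 1) (ball p s)"
  shows "cmod (complex_jacobian f 0 $ i $ j) \<le> 2 * s"
proof -
  define g where "g \<zeta> = f (\<zeta> *s axis j 1) $ i - p $ i" for \<zeta>
  have ball: "\<zeta> *s (axis j 1 :: complex ^ 'n) \<in> ball 0 1" if "cmod \<zeta> < 1" for \<zeta>
    using that by (simp add: norm_vector_scale)
  have der: "(g has_field_derivative (complex_jacobian f (\<zeta> *s axis j 1) *v axis j 1) $ i) (at \<zeta>)"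
    if "cmod \<zeta> < 1" for \<zeta>
    unfolding g_def
    using DERIV_diff[OF slice_has_field_derivative[OF f ball[OF that]] DERIV_const] by simp
  have "g holomorphic_on ball 0 1"
    unfolding holomorphic_on_open[OF open_ball]
    by (intro ballI exI, rule der) simp
  then have hol: "g holomorphic_on cball 0 (1 / 2)" by (rule holomorphic_on_subset) auto
  have "cmod ((deriv ^^ 1) g 0) \<le> fact 1 * s / (1 / 2) ^ 1"
  proof (rule Cauchy_inequality)
    show "g holomorphic_on ball 0 (1 / 2)" using hol by (rule holomorphic_on_subset) auto
    show "continuous_on (cball 0 (1 / 2)) g" using hol by (rule holomorphic_on_imp_continuous_on)
    fix \<zeta> :: complex assume "cmod (0 - \<zeta>) = 1 / 2"
    then have "f (\<zeta> *s axis j 1) \<in> ball p s"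
      using f ball[of \<zeta>] unfolding holomorphic_maps_def by (auto simp: image_subset_iff)
    then have "norm (f (\<zeta> *s axis j 1) - p) < s" by (simp add: dist_norm norm_minus_commute)
    then show "cmod (g \<zeta>) \<le> s"
      using Finite_Cartesian_Product.norm_nth_le[of "f (\<zeta> *s axis j 1) - p" i] by (simp add: g_def)
  qed simp
  moreover have "deriv g 0 = complex_jacobian f 0 $ i $ j"
    using DERIV_imp_deriv[OF der[of 0]]
    by (simp add: matrix_vector_mult_def axis_def if_distrib cong: if_cong)
  ultimately show ?thesis by simp
qed

text \<open>
By Cauchy's inequality the entries of the Jacobian matrices of all competing maps are uniformly
bounded, and so are their determinants.
\<close>

lemma kobayashi_volume_pos_bounded:
  fixes W :: "(complex ^ 'n) set"
  assumes "W \<subseteq> ball p s"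
  shows "0 < kobayashi_volume W z"
proof -
  define M where "M = (card {q. q permutes (UNIV :: 'n set)} * (2 * s) ^ CARD('n))\<^sup>2"
  have "inverse (ennreal M) \<le> kobayashi_volume W z"
    unfolding kobayashi_volume_def
  proof (rule INF_greatest)
    fix f :: "complex ^ 'n \<Rightarrow> complex ^ 'n"
    assume "f \<in> {\<psi> \<in> holomorphic_maps (ball 0 1) W. \<psi> 0 = z}"
    then have "f \<in> holomorphic_maps (ball 0 1) (ball p s)"
      using assms unfolding holomorphic_maps_def by auto
    from cmod_det_le[OF cmod_jacobian_entry_le[OF this]]
    have "(cmod (det (complex_jacobian f 0)))\<^sup>2 \<le> M"
      unfolding M_def by (intro power_mono) auto
    then show "inverse (ennreal M) \<le> inverse (ennreal ((cmod (det (complex_jacobian f 0)))\<^sup>2))"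
      by (simp add: ennreal_leI inverse_ennreal_antimono)
  qed
  moreover have "0 < inverse (ennreal M)" by (simp add: ennreal_inverse_positive)
  ultimately show ?thesis by (rule less_le_trans[rotated])
qed

lemma kobayashi_volume_antimono:
  assumes "W \<subseteq> D"
  shows "kobayashi_volume D z \<le> kobayashi_volume W z"
  unfolding kobayashi_volume_def
  by (rule INF_superset_mono) (use assms in \<open>auto simp: holomorphic_maps_def\<close>)

lemma caratheodory_volume_antimono:
  assumes "W \<subseteq> D"
  shows "caratheodory_volume D z \<le> caratheodory_volume W z"
  unfolding caratheodory_volume_def
  by (rule SUP_subset_mono) (use assms in \<open>auto simp: holomorphic_maps_def\<close>)

text \<open>
The Caratheodory volume element only grows when the domain shrinks, so an estimate for the
quotient follows from one for the denominator.
\<close>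

lemma quotient_invariant_compare:
  assumes W: "W \<subseteq> D" and e: "e * kobayashi_volume W z \<le> kobayashi_volume D z" "0 < e" "e < top"
  shows "e * quotient_invariant D z \<le> quotient_invariant W z"
proof -
  have "inverse (kobayashi_volume D z) \<le> inverse (e * kobayashi_volume W z)"
    using e(1) by (rule inverse_ennreal_antimono)
  also have "\<dots> = inverse e * inverse (kobayashi_volume W z)"
    using e(2,3) by (intro ennreal_inverse_mult') auto
  finally have "e * inverse (kobayashi_volume D z) \<le> e * (inverse e * inverse (kobayashi_volume W z))"
    by (rule mult_left_mono) simp
  also have "\<dots> = inverse (kobayashi_volume W z)"
    using ennreal_divide_self[of e] e(2,3) by (simp add: divide_ennreal_def flip: mult.assoc)
  finally have "caratheodory_volume D z * (e * inverse (kobayashi_volume D z))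
      \<le> caratheodory_volume W z * inverse (kobayashi_volume W z)"
    by (intro mult_mono caratheodory_volume_antimono W) auto
  then show ?thesis by (simp add: quotient_invariant_def divide_ennreal_def mult_ac)
qed

section \<open>Localization at the peak point\<close>

lemma exp_minus_double_le:
  fixes x :: real
  assumes "0 \<le> x" "x \<le> 1 / 2"
  shows "exp (- (2 * x)) \<le> 1 - x"
proof -
  have "0 \<le> x * (1 - 2 * x)" using assms by simp
  then have "1 \<le> (1 - x) * (1 + 2 * x)" by (simp add: algebra_simps)
  also have "\<dots> \<le> (1 - x) * exp (2 * x)"
    using assms by (intro mult_left_mono) auto
  finally show ?thesis by (simp add: exp_minus field_simps)
qed

text \<open>
The one-dimensional estimate on the complex line through 0 and w.
\<close>

lemma ball_escape_estimate:
  fixes f :: "complex ^ 'm \<Rightarrow> complex ^ 'n"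
  assumes D: "open D"
    and S: "disc_superharmonic_on D S" "continuous_on D S" "\<And>w. w \<in> D \<Longrightarrow> 0 \<le> S w"
    and c: "0 \<le> c" "\<And>w. w \<in> D \<Longrightarrow> s\<^sub>1 \<le> dist p w \<Longrightarrow> c \<le> S w" and s: "s\<^sub>1 < s\<^sub>2"
    and f: "f \<in> holomorphic_maps (ball 0 1) D"
    and w: "norm w < 1" "s\<^sub>2 \<le> dist p (f w)"
  shows "c * (1 - norm w) \<le> 20 * S (f 0)"
proof -
  define v :: "complex ^ 'm" where "v = (if w = 0 then 0 else of_real (1 / norm w) *s w)"
  have nv: "norm v \<le> 1" by (simp add: v_def norm_vector_scale norm_divide)
  have wv: "of_real (norm w) *s v = w" by (simp add: v_def)
  have inb: "\<zeta> *s v \<in> ball 0 1" if "\<zeta> \<in> ball 0 1" for \<zeta>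
  proof -
    have "norm (\<zeta> *s v) \<le> cmod \<zeta> * 1" unfolding norm_vector_scale using nv by (intro mult_left_mono) auto
    then show ?thesis using that by simp
  qed
  have "c * (1 - cmod (of_real (norm w))) \<le> 20 * S (f (0 *s v))"
  proof (rule disc_escape_estimate[OF D S c s])
    show "(\<lambda>\<zeta>. f (\<zeta> *s v) $ i) holomorphic_on ball 0 1" for i
      unfolding holomorphic_on_open[OF open_ball]
      by (intro ballI exI, rule slice_has_field_derivative[OF f inb])
    show "(\<lambda>\<zeta>. f (\<zeta> *s v)) ` ball 0 1 \<subseteq> D"
      using f inb unfolding holomorphic_maps_def by blast
  qed (use w wv in auto)
  then show ?thesis by simp
qed

text \<open>
The part of the closure of D in the shell between the radii s / 2 and s is compact and avoids p,
so the peak function is at most some - c < 0 there. Truncated at height c, the negative of the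
peak function is constant on the shell and extends to D, however large or wild D is outside the
ball.
\<close>

lemma local_psh_peak_function_barrier:
  fixes D U0 U :: "(complex ^ 'n) set" and \<phi> :: "complex ^ 'n \<Rightarrow> ereal"
  assumes D: "open D" "p \<in> frontier D" and peak: "local_psh_peak_function D p U0 \<phi>"
    and U: "open U" "p \<in> U"
  obtains S s c where "0 < s" "0 < c" "cball p s \<subseteq> U \<inter> U0"
    "disc_superharmonic_on D S" "continuous_on D S" "\<And>w. 0 \<le> S w"
    "\<And>w. s / 2 \<le> dist p w \<Longrightarrow> S w = c"
    "\<And>w. w \<in> D \<inter> ball p s \<Longrightarrow> S w < c \<Longrightarrow> \<phi> w = ereal (- S w)"
    "\<And>w. w \<in> D \<inter> ball p s \<Longrightarrow> ereal (- c) < \<phi> w \<Longrightarrow> S w < c"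
proof -
  have U0: "open U0" "p \<in> U0" and psh: "plurisubharmonic_on (D \<inter> U0) \<phi>"
    and cont: "continuous_on (closure D \<inter> U0) \<phi>"
    and neg: "\<And>z. z \<in> closure D \<Longrightarrow> z \<in> U0 \<Longrightarrow> z \<noteq> p \<Longrightarrow> \<phi> z < 0"
    using peak unfolding local_psh_peak_function_def by auto
  obtain s where s: "0 < s" "cball p s \<subseteq> U \<inter> U0"
    using U U0 open_contains_cball[of "U \<inter> U0"] by blast
  have pD: "p \<notin> D" using D by (simp add: frontier_def interior_open)
  define X where "X = closure D \<inter> (cball p s - ball p (s / 2))"
  have compX: "compact X" unfolding X_def
    by (intro closed_Int_compact closed_closure compact_diff) auto
  have Xsub: "X \<subseteq> closure D \<inter> U0" using s by (auto simp: X_def)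
  have "\<exists>c>0. \<forall>w\<in>X. \<phi> w \<le> ereal (- c)"
  proof (cases "X = {}")
    case False
    then obtain x where x: "x \<in> X" "\<And>w. w \<in> X \<Longrightarrow> \<phi> w \<le> \<phi> x"
      using continuous_attains_sup[OF compX _ continuous_on_subset[OF cont Xsub]] by metis
    have "\<phi> x < 0" using x(1) Xsub s(1) by (intro neg) (auto simp: X_def)
    then obtain e where "\<phi> x < ereal e" "ereal e < 0" using ereal_dense2 by blast
    then show ?thesis using x(2) by (intro exI[of _ "- e"]) (auto intro: order_trans less_imp_le)
  qed (auto intro: exI[of _ 1])
  then obtain c where c: "0 < c" "\<And>w. w \<in> X \<Longrightarrow> \<phi> w \<le> ereal (- c)" by blast
  have DU: "D \<inter> ball p s \<subseteq> closure D \<inter> U0" using s closure_subset[of D] by auto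
  have h1: "ball p s \<subseteq> U0" using s by auto
  have h2: "continuous_on (D \<inter> ball p s) \<phi>" using cont DU by (rule continuous_on_subset)
  have h3: "\<phi> w < 0" if "w \<in> D \<inter> ball p s" for w
    using that DU pD by (intro neg) auto
  have h4: "\<phi> w \<le> ereal (- c)" if "w \<in> D \<inter> ball p s" "s / 2 \<le> dist p w" for w
    using that closure_subset[of D] by (intro c(2)) (auto simp: X_def)
  have h5: "s / 2 < s" using s by simp
  note hyps = D(1) psh h1 h2 h3 h4 h5 c(1)
  let ?S = "truncated_barrier D \<phi> p s c"
  show ?thesis
  proof (rule that[of s c ?S])
    show "disc_superharmonic_on D ?S" by (rule disc_superharmonic_on_truncated_barrier[OF hyps])
    show "continuous_on D ?S" by (rule continuous_on_truncated_barrier[OF hyps])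
    show "0 \<le> ?S w" for w by (rule truncated_barrier_bounds(1)[OF hyps])
    show "?S w = c" if "s / 2 \<le> dist p w" for w by (rule truncated_barrier_outer[OF hyps that])
    show "\<phi> w = ereal (- ?S w)" if "w \<in> D \<inter> ball p s" "?S w < c" for w
      by (rule truncated_barrier_eq[OF hyps that])
    show "?S w < c" if w: "w \<in> D \<inter> ball p s" "ereal (- c) < \<phi> w" for w
    proof -
      have "- \<phi> w < ereal c" using w(2) by (metis ereal_uminus_less_reorder uminus_ereal.simps(1))
      moreover have "ereal (?S w) = min (- \<phi> w) (ereal c)"
        by (rule ereal_truncated_barrier[OF hyps w(1)])
      ultimately have "ereal (?S w) < ereal c" by (metis min_less_iff_disj)
      then show ?thesis by simp
    qed
  qed (use s c in auto)
qed

theorem theorem1p1: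
  fixes D U0 U :: "(complex ^ 'n) set" and p :: "complex ^ 'n" and \<phi> :: "complex ^ 'n \<Rightarrow> ereal"
  assumes "open D" and "connected D" and "D \<noteq> {}"
    and "p \<in> frontier D"
    and "local_psh_peak_function D p U0 \<phi>"
    and "open U" and "p \<in> U"
  shows "\<exists>V m. open V \<and> p \<in> V \<and> V \<subseteq> U \<and> D \<inter> V \<subseteq> U0 \<and> (m :: real) > 0 \<and>
    (\<forall>z \<in> D \<inter> V.
       kobayashi_volume D z \<ge> exp_ereal (ereal m * \<phi> z) * kobayashi_volume (D \<inter> U) z \<and>
       kobayashi_volume D z > 0 \<and> kobayashi_volume (D \<inter> U) z > 0 \<and>
       quotient_invariant (D \<inter> U) z \<ge> exp_ereal (ereal m * \<phi> z) * quotient_invariant D z)"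
proof -
  obtain S s c where s: "0 < s" "0 < c" "cball p s \<subseteq> U \<inter> U0"
    and S: "disc_superharmonic_on D S" "continuous_on D S" "\<And>w. 0 \<le> S w"
      "\<And>w. s / 2 \<le> dist p w \<Longrightarrow> S w = c"
    and S\<phi>: "\<And>w. w \<in> D \<inter> ball p s \<Longrightarrow> S w < c \<Longrightarrow> \<phi> w = ereal (- S w)"
      "\<And>w. w \<in> D \<inter> ball p s \<Longrightarrow> ereal (- c) < \<phi> w \<Longrightarrow> S w < c"
    using local_psh_peak_function_barrier[OF assms(1,4-7)] by metis
  have peak: "continuous_on (closure D \<inter> U0) \<phi>" "\<phi> p = 0" "p \<in> U0"
    using assms(5) unfolding local_psh_peak_function_def by auto
  have "p \<in> closure D \<inter> U0" using assms(4) peak by (simp add: frontier_def)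
  moreover have "\<phi> p \<in> {ereal (- c / 40)<..}" using peak s(2) by simp
  ultimately obtain A where A: "open A" "p \<in> A"
    "\<And>w. w \<in> closure D \<inter> U0 \<Longrightarrow> w \<in> A \<Longrightarrow> ereal (- c / 40) < \<phi> w"
    using peak(1) unfolding continuous_on_topological
    by (metis greaterThan_iff open_greaterThan)
  define V where "V = A \<inter> ball p s"
  \<comment> \<open>Chosen so that m S z = 4 n x with x = 20 S z / c, and exp (- 2 x) \<le> 1 - x for x at most 1 / 2.\<close>
  define m where "m = 80 * real CARD('n) / c"
  have m: "0 < m" using s(2) by (simp add: m_def)
  let ?W = "D \<inter> ball p s"
  \<comment> \<open>The estimates are proved for the bounded set ?W, whose volume element is positive and dominates that of D \<inter> U.\<close>
  have main: "kobayashi_volume D z \<ge> exp_ereal (ereal m * \<phi> z) * kobayashi_volume (D \<inter> U) z \<and>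
       kobayashi_volume D z > 0 \<and> kobayashi_volume (D \<inter> U) z > 0 \<and>
       quotient_invariant (D \<inter> U) z \<ge> exp_ereal (ereal m * \<phi> z) * quotient_invariant D z"
    if z: "z \<in> D \<inter> V" for z
  proof -
    have zb: "z \<in> D \<inter> ball p s" using z by (auto simp: V_def)
    have zU0: "z \<in> closure D \<inter> U0" using zb s(3) closure_subset[of D] by auto
    have gt: "ereal (- c / 40) < \<phi> z" using A(3)[OF zU0] z by (simp add: V_def)
    have "ereal (- c) < \<phi> z" by (rule le_less_trans[OF _ gt]) (use s(2) in simp)
    from S\<phi>(1)[OF zb S\<phi>(2)[OF zb this]] have \<phi>z: "\<phi> z = ereal (- S z)" .
    have Sz: "0 \<le> S z" "S z < c / 40" using S(3) gt \<phi>z by auto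
    \<comment> \<open>Every map of the ball into D with centre z sends the ball of radius 1 - x into ?W.\<close>
    define x where "x = 20 * S z / c"
    have x: "0 \<le> x" "x \<le> 1 / 2" using Sz s(2) by (auto simp: x_def field_simps)
    define e where "e = exp_ereal (ereal m * \<phi> z)"
    have e: "e = ennreal (exp (- (m * S z)))" by (simp add: e_def \<phi>z exp_ereal_def)
    have e_le: "e \<le> ennreal ((1 - x) ^ (2 * CARD('n)))"
    proof -
      have "exp (- (m * S z)) = exp (- (2 * x)) ^ (2 * CARD('n))"
        using s(2) by (simp add: m_def x_def field_simps flip: exp_of_nat_mult)
      also have "\<dots> \<le> (1 - x) ^ (2 * CARD('n))"
        using exp_minus_double_le[OF x] by (intro power_mono) auto
      finally show ?thesis unfolding e by (rule ennreal_leI)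
    qed
    have W_le_D: "e * kobayashi_volume ?W z \<le> kobayashi_volume D z"
    proof -
      have "e * kobayashi_volume ?W z \<le> ennreal ((1 - x) ^ (2 * CARD('n))) * kobayashi_volume ?W z"
        using e_le by (rule mult_right_mono) simp
      also have "\<dots> \<le> kobayashi_volume D z"
      proof (rule kobayashi_volume_localization)
        fix f :: "complex ^ 'n \<Rightarrow> complex ^ 'n" and w :: "complex ^ 'n"
        assume f: "f \<in> holomorphic_maps (ball 0 1) D" "f 0 = z" and w: "norm w < 1 - x"
        have w1: "norm w < 1" using w x by simp
        have "dist p (f w) < s"
        proof (rule ccontr)
          assume "\<not> ?thesis"
          then have "c * (1 - norm w) \<le> 20 * S (f 0)"
            using s S by (intro ball_escape_estimate[OF assms(1) S(1,2) _ _ _ _ f(1) w1,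
                  where s\<^sub>1 = "s / 2" and s\<^sub>2 = s and p = p]) auto
          then have "1 - norm w \<le> x" using s(2) by (simp add: f x_def field_simps)
          then show False using w by simp
        qed
        moreover have "f w \<in> D" using f(1) w1 unfolding holomorphic_maps_def by auto
        ultimately show "f w \<in> ?W" by simp
      qed (use x in auto)
      finally show ?thesis .
    qed
    have "kobayashi_volume (D \<inter> U) z \<le> kobayashi_volume ?W z"
      using s(3) by (intro kobayashi_volume_antimono) auto
    then have "e * kobayashi_volume (D \<inter> U) z \<le> e * kobayashi_volume ?W z"
      by (rule mult_left_mono) simp
    then have i: "e * kobayashi_volume (D \<inter> U) z \<le> kobayashi_volume D z"
      using W_le_D by (rule order_trans)
    have e_pos: "0 < e" "e < top" by (simp_all add: e)
    have "0 < kobayashi_volume ?W z" by (rule kobayashi_volume_pos_bounded[of _ p s]) simp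
    then have "0 < e * kobayashi_volume ?W z" using e_pos by (simp add: ennreal_zero_less_mult_iff)
    then have D_pos: "0 < kobayashi_volume D z" using W_le_D by (rule less_le_trans)
    then have U_pos: "0 < kobayashi_volume (D \<inter> U) z"
      by (rule less_le_trans) (rule kobayashi_volume_antimono, simp)
    have "e * quotient_invariant D z \<le> quotient_invariant (D \<inter> U) z"
      by (rule quotient_invariant_compare[OF _ i e_pos]) simp
    then show ?thesis using i D_pos U_pos unfolding e_def by blast
  qed
  have "open V" "p \<in> V" "V \<subseteq> U" "D \<inter> V \<subseteq> U0"
    using A s by (auto simp: V_def)
  then show ?thesis using main m by (intro exI[of _ V] exI[of _ m]) blast
qed

end
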